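(* Let $d,L\ge 1$ be integers, let $C>0$, let $\varepsilon\in(0,1)$, and let $\mathbf{Y}^0\in L^2(\mathbb{R}^d)$ be an input. Put $$\omega_c:=\Omega_\varepsilon^\sharp(L):=\inf\Bigl\{\Omega>0:\; C^{2L}\int_{|\xi|>\Omega}(1+|\xi|)^{-2L}\,|\widehat{\mathbf{Y}^0}(\xi)|^2\,d\xi\le\varepsilon\,\|\mathbf{Y}^0\|_2^2\Bigr\}.$$ Let $\mathbf{Y}\in L^2(\mathbb{R}^d)$ and set $\mathbf{Y}_{\text{high}}=P_{\mathcal{B}_{\omega_c}^{\perp}}(\mathbf{Y})$. If $\|\mathbf{Y}_{\text{high}}\|_2>\sqrt{\varepsilon}\,\|\mathbf{Y}^0\|_2$, then every output $\mathbf{Y}^t$ of a depth-$L$ CNN (with envelope constant $C$) with input $\mathbf{Y}^0$ satisfies $$\|\mathbf{Y}-\mathbf{Y}^t\|_2^2\;\ge\;\bigl(\|\mathbf{Y}_{\text{high}}\|_2-\sqrt{\varepsilon}\,\|\mathbf{Y}^0\|_2\bigr)^2\;>\;0,$$ so the approximation error is not eliminated by any such depth-$L$ CNN.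
   Context: The Fourier transform $\widehat{f}=\mathcal{F}f$ is normalized to be unitary on $L^2(\mathbb{R}^d)$, e.g. $\widehat f(\xi)=\int f(x)e^{-2\pi i x\cdot\xi}\,dx$ for integrable $f$. For a cutoff $\omega_c$, $\mathcal{B}_{\omega_c}=\{f\in L^2(\mathbb{R}^d):\operatorname{supp}\widehat f\subseteq\{|\xi|\le\omega_c\}\}$, with orthogonal complement $\mathcal{B}_{\omega_c}^\perp$; the orthogonal projections are $P_{\mathcal{B}_{\omega_c}}f=\mathcal{F}^{-1}(\mathbf{1}_{\{|\xi|\le\omega_c\}}\widehat f)$ and $P_{\mathcal{B}_{\omega_c}^\perp}f=f-P_{\mathcal{B}_{\omega_c}}f$. A depth-$L$ CNN is modeled as $L$ consecutive convolutions with kernels $k_1,\dots,k_L\in L^1(\mathbb{R}^d)$, each compactly supported and of finite total variation ($k_\ell\in BV(\mathbb{R}^d)$). Its composite frequency response is $H_L(\xi)=\prod_{\ell=1}^L\widehat{k_\ell}(\xi)$. It has envelope constant $C$ if $|H_L(\xi)|\le C^L(1+|\xi|)^{-L}$ for all $\xi\in\mathbb{R}^d$. The output of the CNN on input $f\in L^2(\mathbb{R}^d)$ is the function $g\in L^2(\mathbb{R}^d)$ with $\widehat g=H_L\,\widehat f$. *)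

theory Defs
  imports "HOL-Analysis.Analysis"
begin

text \<open>
  Elements of \<open>L\<^sup>1\<close> and \<open>L\<^sup>2\<close> are represented by (complex-valued, Lebesgue measurable) functions.
  Equality of such elements is therefore equality almost everywhere.
\<close>

definition L2 :: "('a::euclidean_space \<Rightarrow> complex) set" where
  "L2 = {f \<in> borel_measurable lebesgue. integrable lebesgue (\<lambda>x. (norm (f x))\<^sup>2)}"

definition L2_norm :: "('a::euclidean_space \<Rightarrow> complex) \<Rightarrow> real" where
  "L2_norm f = sqrt (\<integral>x. (norm (f x))\<^sup>2 \<partial>lebesgue)"

definition fourier_integral :: "('a::euclidean_space \<Rightarrow> complex) \<Rightarrow> 'a \<Rightarrow> complex" where
  "fourier_integral f \<xi> = (\<integral>x. f x * exp (- 2 * of_real pi * \<i> * of_real (x \<bullet> \<xi>)) \<partial>lebesgue)"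

text \<open>
  The unitary Fourier transform on \<open>L\<^sup>2\<close>: the limit in \<open>L\<^sup>2\<close>, as \<open>R \<rightarrow> \<infinity>\<close>, of the Fourier integrals of
  the truncations of \<open>f\<close> to the balls of radius \<open>R\<close>. These truncations are in \<open>L\<^sup>1 \<inter> L\<^sup>2\<close>, so that by
  Plancherel's theorem their Fourier integrals are in \<open>L\<^sup>2\<close> and the limit exists. The limit is unique
  only up to null sets; an arbitrary representative is selected.
\<close>

definition fourier_L2 :: "('a::euclidean_space \<Rightarrow> complex) \<Rightarrow> 'a \<Rightarrow> complex" where
  "fourier_L2 f = (SOME g. g \<in> L2 \<and>
     ((\<lambda>R. L2_norm (\<lambda>\<xi>. fourier_integral (\<lambda>x. indicator (cball 0 R) x * f x) \<xi> - g \<xi>)) \<longlongrightarrow> 0) at_top)"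

definition inv_fourier_L2 :: "('a::euclidean_space \<Rightarrow> complex) \<Rightarrow> 'a \<Rightarrow> complex" where
  "inv_fourier_L2 h = (SOME f. f \<in> L2 \<and> (AE \<xi> in lebesgue. fourier_L2 f \<xi> = h \<xi>))"

text \<open>
  The orthogonal projections onto the space of \<open>f \<in> L\<^sup>2\<close> whose Fourier transform is supported in
  \<open>{\<xi>. norm \<xi> \<le> \<omega>}\<close>, and onto its orthogonal complement.
\<close>

definition proj_low :: "real \<Rightarrow> ('a::euclidean_space \<Rightarrow> complex) \<Rightarrow> 'a \<Rightarrow> complex" where
  "proj_low \<omega> f = inv_fourier_L2 (\<lambda>\<xi>. indicator {\<xi>. norm \<xi> \<le> \<omega>} \<xi> * fourier_L2 f \<xi>)"

definition proj_high :: "real \<Rightarrow> ('a::euclidean_space \<Rightarrow> complex) \<Rightarrow> 'a \<Rightarrow> complex" where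
  "proj_high \<omega> f = (\<lambda>x. f x - proj_low \<omega> f x)"

text \<open>
  The total variation of a complex-valued \<open>k\<close> is the supremum of \<open>Re (\<integral> k div \<phi>)\<close> over the
  \<open>C\<^sup>1\<close> vector fields \<open>\<phi>\<close> with values in \<open>\<complex>\<^sup>d\<close>, compact support and Euclidean norm at most 1. The set
  below consists of the divergences of these fields.
\<close>

definition test_divergences :: "(real^'n \<Rightarrow> complex) set" where
  "test_divergences = {(\<lambda>x. \<Sum>i\<in>UNIV. blinfun_apply (D x) (axis i 1) $ i) | (\<phi> :: real^'n \<Rightarrow> complex^'n) D.
     (\<forall>x. (\<phi> has_derivative blinfun_apply (D x)) (at x)) \<and> continuous_on UNIV D \<and>
     compact (closure {x. \<phi> x \<noteq> 0}) \<and> (\<forall>x. norm (\<phi> x) \<le> 1)}"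

definition total_variation :: "(real^'n \<Rightarrow> complex) \<Rightarrow> ereal" where
  "total_variation k = (SUP \<psi>\<in>test_divergences. ereal (Re (\<integral>x. k x * \<psi> x \<partial>lebesgue)))"

text \<open>
  Compact support refers to the essential support, since \<open>k\<close> represents an element of \<open>L\<^sup>1\<close>.
\<close>

definition cnn_kernel :: "(real^'n \<Rightarrow> complex) \<Rightarrow> bool" where
  "cnn_kernel k \<longleftrightarrow> integrable lebesgue k \<and>
     (\<exists>K. compact K \<and> (AE x in lebesgue. x \<notin> K \<longrightarrow> k x = 0)) \<and>
     total_variation k < \<infinity>"

definition freq_response :: "nat \<Rightarrow> (nat \<Rightarrow> 'a::euclidean_space \<Rightarrow> complex) \<Rightarrow> 'a \<Rightarrow> complex" where
  "freq_response L k \<xi> = (\<Prod>l=1..L. fourier_integral (k l) \<xi>)"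

definition envelope_constant :: "nat \<Rightarrow> real \<Rightarrow> (nat \<Rightarrow> 'a::euclidean_space \<Rightarrow> complex) \<Rightarrow> bool" where
  "envelope_constant L C k \<longleftrightarrow> (\<forall>\<xi>. norm (freq_response L k \<xi>) \<le> C ^ L * (1 + norm \<xi>) powi (- int L))"

definition cnn_output ::
  "nat \<Rightarrow> (nat \<Rightarrow> 'a::euclidean_space \<Rightarrow> complex) \<Rightarrow> ('a \<Rightarrow> complex) \<Rightarrow> ('a \<Rightarrow> complex) \<Rightarrow> bool" where
  "cnn_output L k f g \<longleftrightarrow> g \<in> L2 \<and>
     (AE \<xi> in lebesgue. fourier_L2 g \<xi> = freq_response L k \<xi> * fourier_L2 f \<xi>)"

definition cutoff :: "real \<Rightarrow> real \<Rightarrow> ('a::euclidean_space \<Rightarrow> complex) \<Rightarrow> nat \<Rightarrow> real" where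
  "cutoff C \<epsilon> f L = Inf {\<Omega>. \<Omega> > 0 \<and>
     C ^ (2 * L) * (LINT \<xi>:{\<xi>. norm \<xi> > \<Omega>}|lebesgue. (1 + norm \<xi>) powi (- 2 * int L) * (norm (fourier_L2 f \<xi>))\<^sup>2)
       \<le> \<epsilon> * (L2_norm f)\<^sup>2}"

end

theory Submission
  imports Defs "HOL-Probability.Characteristic_Functions" "HOL-Real_Asymp.Real_Asymp"
begin

text \<open>
  By Plancherel's theorem the claim is one about Fourier transforms: dropping the frequencies
  \<open>norm \<xi> \<le> \<omega>\<^sub>c\<close> does not increase the distance of \<open>Y\<close> and \<open>Yt\<close>, and on the remaining frequencies the
  envelope and the choice of the cutoff bound the norm of the transform of \<open>Yt\<close> by
  \<open>sqrt \<epsilon> * L2_norm Y0\<close>.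

  For Plancherel's theorem, weighting \<open>|fourier_integral f|\<^sup>2\<close> with a wide Gaussian turns its integral
  into the average of the autocorrelation of \<open>f\<close> over a narrow Gaussian. As the autocorrelation is at
  most \<open>\<parallel>f\<parallel>\<^sup>2\<close>, the Fourier integral is a contraction; as it is continuous for compactly
  supported continuous \<open>f\<close>, which are dense, the Fourier integral is an isometry. Surjectivity of the
  extension to \<open>L\<^sup>2\<close> follows because its adjoint is an isometry, too.
\<close>


section \<open>The space \<open>L\<^sup>2\<close>\<close>

text \<open>The Gaussian weight answers an obstacle: expanding the square modulus of a Fourier
  integral gives a triple integral that is not absolutely convergent in the frequency, so Fubini's
  theorem does not apply to it directly. A weight with an explicit, positive and integrable
  transform repairs this, and \<open>exp (- pi * (norm x)\<^sup>2)\<close> is its own transform in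
  the unitary normalization. When the weight is removed, square integrability of the transform is
  not yet known; Fatou's lemma extracts it from the uniform bound. Two features of the definitions
  shape the rest. Elements of L2 are Lebesgue measurable, whereas Fubini's theorem and substitution
  are carried out over \<open>lborel\<close>, so the estimates are proved for Borel functions and
  carried over to representatives. Moreover, \<open>fourier_L2\<close> and
  \<open>inv_fourier_L2\<close> are choices, about which nothing is known before existence is shown:
  completeness of L2 provides the limit in the former and surjectivity the preimage in the latter,
  and only then does \<open>proj_low\<close> have its meaning. In the same way \<open>cutoff\<close>
  is an infimum, meaningful once its set is nonempty.\<close>

lemma L2_measurable [measurable_dest]: "f \<in> L2 \<Longrightarrow> f \<in> borel_measurable lebesgue"
  by (simp add: L2_def)

lemma L2_integrable: "f \<in> L2 \<Longrightarrow> integrable lebesgue (\<lambda>x. (norm (f x))\<^sup>2)"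
  by (simp add: L2_def)

lemma L2_norm_nonneg [simp]: "0 \<le> L2_norm f"
  by (simp add: L2_norm_def)

lemma L2_norm_power2: "(L2_norm f)\<^sup>2 = (\<integral>x. (norm (f x))\<^sup>2 \<partial>lebesgue)"
  by (simp add: L2_norm_def)

lemma L2_dominated:
  fixes f :: "'a::euclidean_space \<Rightarrow> complex"
  assumes "g \<in> L2" and f: "f \<in> borel_measurable lebesgue"
    and le: "AE x in lebesgue. norm (f x) \<le> norm (g x)"
  shows "f \<in> L2"
proof -
  have "integrable lebesgue (\<lambda>x. (norm (f x))\<^sup>2)"
    using le f by (intro Bochner_Integration.integrable_bound[OF L2_integrable[OF assms(1)]])
      (auto intro: power_mono elim!: eventually_mono)
  with f show ?thesis by (simp add: L2_def)
qed

lemma L2_norm_mono: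
  assumes "f \<in> L2" "g \<in> L2" and le: "AE x in lebesgue. norm (f x) \<le> norm (g x)"
  shows "L2_norm f \<le> L2_norm g"
  unfolding L2_norm_def using le
  by (intro real_sqrt_le_mono integral_mono_AE L2_integrable assms)
    (auto intro: power_mono elim!: eventually_mono)

lemma L2_norm_cong_AE:
  assumes "f \<in> borel_measurable lebesgue" "g \<in> borel_measurable lebesgue"
    and "AE x in lebesgue. norm (f x) = norm (g x)"
  shows "L2_norm f = L2_norm g"
  unfolding L2_norm_def using assms
  by (intro arg_cong[where f = sqrt] integral_cong_AE) (auto elim!: eventually_mono)

lemma L2_cong_AE:
  assumes "f \<in> L2" "g \<in> borel_measurable lebesgue" "AE x in lebesgue. norm (f x) = norm (g x)"
  shows "g \<in> L2"
  using assms by (intro L2_dominated[OF assms(1)]) (auto elim!: eventually_mono)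

lemma borel_measurable_cnj [measurable (raw)]:
  "f \<in> borel_measurable M \<Longrightarrow> (\<lambda>x. cnj (f x)) \<in> borel_measurable M"
  by (rule measurable_compose[of f M borel cnj]) (simp_all add: borel_measurable_continuous_onI continuous_on_cnj)

lemma L2_cnj: "f \<in> L2 \<Longrightarrow> (\<lambda>x. cnj (f x)) \<in> L2"
  by (rule L2_dominated[of f]) (simp_all add: borel_measurable_cnj L2_measurable)

lemma L2_norm_cnj: "L2_norm (\<lambda>x. cnj (f x)) = L2_norm f"
  by (simp add: L2_norm_def)

lemma L2_mult_bounded:
  fixes f :: "'a::euclidean_space \<Rightarrow> complex"
  assumes "f \<in> L2" and [measurable]: "a \<in> borel_measurable lebesgue" and "\<And>x. norm (a x) \<le> 1"
  shows "(\<lambda>x. a x * f x) \<in> L2"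
  using assms by (intro L2_dominated[OF assms(1)]) (auto simp: norm_mult mult_left_le_one_le)

lemma integrable_L2_mult:
  assumes f: "f \<in> L2" and g: "g \<in> L2"
  shows "integrable lebesgue (\<lambda>x. f x * g x)"
proof (rule Bochner_Integration.integrable_bound)
  show "integrable lebesgue (\<lambda>x. (norm (f x))\<^sup>2 + (norm (g x))\<^sup>2)"
    using f g by (intro Bochner_Integration.integrable_add L2_integrable)
  show "(\<lambda>x. f x * g x) \<in> borel_measurable lebesgue" using f g by measurable
  have "norm a * norm b \<le> (norm a)\<^sup>2 + (norm b)\<^sup>2" for a b :: complex
    using sum_squares_bound[of "norm a" "norm b"] mult_nonneg_nonneg[of "norm a" "norm b"]
    by (simp del: mult_nonneg_nonneg)
  then show "AE x in lebesgue. norm (f x * g x) \<le> norm ((norm (f x))\<^sup>2 + (norm (g x))\<^sup>2)"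
    by (simp add: norm_mult)
qed

lemma L2_add:
  assumes f: "f \<in> L2" and g: "g \<in> L2"
  shows "(\<lambda>x. f x + g x) \<in> L2"
proof -
  have "integrable lebesgue (\<lambda>x. (norm (f x + g x))\<^sup>2)"
  proof (rule Bochner_Integration.integrable_bound)
    show "integrable lebesgue (\<lambda>x. 2 * (norm (f x))\<^sup>2 + 2 * (norm (g x))\<^sup>2)"
      using f g by (intro Bochner_Integration.integrable_add integrable_mult_right L2_integrable)
    show "(\<lambda>x. (norm (f x + g x))\<^sup>2) \<in> borel_measurable lebesgue" using f g by measurable
    have "(norm (a + b))\<^sup>2 \<le> 2 * (norm a)\<^sup>2 + 2 * (norm b)\<^sup>2" for a b :: complex
      using power_mono[OF norm_triangle_ineq[of a b], of 2] sum_squares_bound[of "norm a" "norm b"]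
      by (simp add: power2_sum)
    then show "AE x in lebesgue. norm ((norm (f x + g x))\<^sup>2) \<le> norm (2 * (norm (f x))\<^sup>2 + 2 * (norm (g x))\<^sup>2)"
      by simp
  qed
  moreover have "(\<lambda>x. f x + g x) \<in> borel_measurable lebesgue"
    using f g by (intro borel_measurable_add L2_measurable)
  ultimately show ?thesis by (simp add: L2_def)
qed

lemma L2_uminus: "f \<in> L2 \<Longrightarrow> (\<lambda>x. - f x) \<in> L2"
  by (rule L2_cong_AE[of f]) (auto intro!: borel_measurable_uminus L2_measurable)

lemma L2_diff: "f \<in> L2 \<Longrightarrow> g \<in> L2 \<Longrightarrow> (\<lambda>x. f x - g x) \<in> L2"
  using L2_add[OF _ L2_uminus, of f g] by simp

lemma L2_norm_minus_commute: "L2_norm (\<lambda>x. f x - g x) = L2_norm (\<lambda>x. g x - f x)"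
  by (simp add: L2_norm_def norm_minus_commute)

text \<open>The integral of \<open>(norm (f x) * t - norm (g x))\<^sup>2\<close> is a nonnegative
  quadratic polynomial in \<open>t\<close>. Norms stand inside the integral so that one bound serves
  pairings with and without conjugation as well as estimates in L1.\<close>

lemma L2_Cauchy_Schwarz:
  assumes f: "f \<in> L2" and g: "g \<in> L2"
  shows "(\<integral>x. norm (f x) * norm (g x) \<partial>lebesgue) \<le> L2_norm f * L2_norm g"
proof -
  define I where "I = (\<integral>x. norm (f x) * norm (g x) \<partial>lebesgue)"
  have int: "integrable lebesgue (\<lambda>x. norm (f x) * norm (g x))"
    using integrable_norm[OF integrable_L2_mult[OF f g]] by (simp add: norm_mult)
  have "0 \<le> (L2_norm f)\<^sup>2 * t\<^sup>2 - 2 * I * t + (L2_norm g)\<^sup>2" for t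
  proof -
    have "0 \<le> (\<integral>x. (norm (f x) * t - norm (g x))\<^sup>2 \<partial>lebesgue)" by simp
    also have "\<dots> = (\<integral>x. t\<^sup>2 * (norm (f x))\<^sup>2 - (2 * t) * (norm (f x) * norm (g x)) + (norm (g x))\<^sup>2 \<partial>lebesgue)"
      by (simp add: power2_diff algebra_simps power_mult_distrib)
    also have "\<dots> = t\<^sup>2 * (L2_norm f)\<^sup>2 - 2 * t * I + (L2_norm g)\<^sup>2"
      unfolding I_def L2_norm_power2 using int L2_integrable[OF f] L2_integrable[OF g] by simp
    finally show ?thesis by (simp add: algebra_simps)
  qed
  note q = this
  have I0: "0 \<le> I" unfolding I_def by simp
  show ?thesis
  proof (cases "L2_norm f = 0")
    case True
    have "I \<le> 0"
    proof (rule ccontr)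
      assume "\<not> I \<le> 0"
      \<comment> \<open>Without its square term the polynomial is affine with slope
        \<open>- 2 * I\<close>; at this \<open>t\<close> its value is -1.\<close>
      with q[of "((L2_norm g)\<^sup>2 + 1) / (2 * I)"] True show False by simp
    qed
    with True show ?thesis by (simp add: I_def)
  next
    case False
    \<comment> \<open>The point \<open>I / (L2_norm f)\<^sup>2\<close> is the minimizer of the
      polynomial.\<close>
    have "(L2_norm f)\<^sup>2 * (I / (L2_norm f)\<^sup>2)\<^sup>2 - 2 * I * (I / (L2_norm f)\<^sup>2) + (L2_norm g)\<^sup>2
        = ((L2_norm f)\<^sup>2 * (L2_norm g)\<^sup>2 - I\<^sup>2) / (L2_norm f)\<^sup>2"
      using False by (simp add: diff_divide_distrib power_divide power2_eq_square)
    with q[of "I / (L2_norm f)\<^sup>2"] have "I\<^sup>2 \<le> (L2_norm f)\<^sup>2 * (L2_norm g)\<^sup>2"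
      using False by (simp add: zero_le_divide_iff)
    then have "I \<le> L2_norm f * L2_norm g"
      using power2_le_imp_le[of I "L2_norm f * L2_norm g"] by (simp only: power_mult_distrib mult_nonneg_nonneg L2_norm_nonneg)
    then show ?thesis by (simp add: I_def)
  qed
qed

lemma L2_inner_bound:
  assumes "f \<in> L2" "g \<in> L2"
  shows "norm (\<integral>x. f x * g x \<partial>lebesgue) \<le> L2_norm f * L2_norm g"
proof -
  have "norm (\<integral>x. f x * g x \<partial>lebesgue) \<le> (\<integral>x. norm (f x) * norm (g x) \<partial>lebesgue)"
    using integral_norm_bound[of lebesgue "\<lambda>x. f x * g x"] by (simp add: norm_mult)
  also have "\<dots> \<le> L2_norm f * L2_norm g" by (rule L2_Cauchy_Schwarz[OF assms])
  finally show ?thesis .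
qed

lemma L2_norm_triangle:
  assumes f: "f \<in> L2" and g: "g \<in> L2"
  shows "L2_norm (\<lambda>x. f x + g x) \<le> L2_norm f + L2_norm g"
proof (rule power2_le_imp_le)
  have int: "integrable lebesgue (\<lambda>x. norm (f x) * norm (g x))"
    using integrable_norm[OF integrable_L2_mult[OF f g]] by (simp add: norm_mult)
  have "(norm (a + b))\<^sup>2 \<le> (norm a)\<^sup>2 + 2 * (norm a * norm b) + (norm b)\<^sup>2" for a b :: complex
    using power_mono[OF norm_triangle_ineq[of a b], of 2] by (simp add: power2_sum)
  then have "(L2_norm (\<lambda>x. f x + g x))\<^sup>2
      \<le> (\<integral>x. (norm (f x))\<^sup>2 + 2 * (norm (f x) * norm (g x)) + (norm (g x))\<^sup>2 \<partial>lebesgue)"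
    unfolding L2_norm_power2 using f g int
    by (intro integral_mono L2_integrable L2_add Bochner_Integration.integrable_add integrable_mult_right) auto
  also have "\<dots> = (L2_norm f)\<^sup>2 + 2 * (\<integral>x. norm (f x) * norm (g x) \<partial>lebesgue) + (L2_norm g)\<^sup>2"
    unfolding L2_norm_power2 using int L2_integrable[OF f] L2_integrable[OF g] by simp
  also have "\<dots> \<le> (L2_norm f + L2_norm g)\<^sup>2"
    using L2_Cauchy_Schwarz[OF f g] by (simp add: power2_sum)
  finally show "(L2_norm (\<lambda>x. f x + g x))\<^sup>2 \<le> (L2_norm f + L2_norm g)\<^sup>2" .
qed simp

lemma L2_norm_diff_triangle:
  assumes "f \<in> L2" "g \<in> L2" "h \<in> L2"
  shows "L2_norm (\<lambda>x. f x - h x) \<le> L2_norm (\<lambda>x. f x - g x) + L2_norm (\<lambda>x. g x - h x)"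
  using L2_norm_triangle[OF L2_diff[OF assms(1,2)] L2_diff[OF assms(2,3)]] by simp

lemma L2_norm_diff_ineq:
  assumes "f \<in> L2" "g \<in> L2"
  shows "L2_norm f \<le> L2_norm (\<lambda>x. f x - g x) + L2_norm g"
  using L2_norm_triangle[OF L2_diff[OF assms] assms(2)] by simp

lemma L2_norm_eq_0_AE:
  assumes "f \<in> L2" "L2_norm f = 0"
  shows "AE x in lebesgue. f x = 0"
proof -
  have "(\<integral>x. (norm (f x))\<^sup>2 \<partial>lebesgue) = 0"
    using assms(2) by (simp add: L2_norm_power2[symmetric])
  then show ?thesis
    by (subst (asm) integral_nonneg_eq_0_iff_AE) (auto intro: L2_integrable assms)
qed

lemma L2_dominated_convergence:
  fixes f :: "'a::euclidean_space \<Rightarrow> complex"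
  assumes w: "w \<in> L2" and f: "f \<in> borel_measurable lebesgue"
    and u: "\<And>n. u n \<in> borel_measurable lebesgue"
    and lim: "AE x in lebesgue. (\<lambda>n. u n x) \<longlonglongrightarrow> f x"
    and le: "\<And>n. AE x in lebesgue. norm (u n x) \<le> norm (w x)"
  shows "f \<in> L2" and "(\<lambda>n. L2_norm (\<lambda>x. u n x - f x)) \<longlonglongrightarrow> 0"
proof -
  have "AE x in lebesgue. \<forall>n. norm (u n x) \<le> norm (w x)"
    using le by (simp add: AE_all_countable)
  with lim have fw: "AE x in lebesgue. norm (f x) \<le> norm (w x)"
  proof eventually_elim
    case (elim x)
    then show ?case by (intro tendsto_upperbound[OF tendsto_norm[OF elim(1)]]) auto
  qed
  then show "f \<in> L2" by (rule L2_dominated[OF w f])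
  have "(\<lambda>n. \<integral>x. (norm (u n x - f x))\<^sup>2 \<partial>lebesgue) \<longlonglongrightarrow> (\<integral>x. 0 \<partial>(lebesgue :: 'a measure))"
  proof (rule integral_dominated_convergence)
    show "integrable lebesgue (\<lambda>x. 4 * (norm (w x))\<^sup>2)"
      using L2_integrable[OF w] by simp
    show "AE x in lebesgue. (\<lambda>n. (norm (u n x - f x))\<^sup>2) \<longlonglongrightarrow> 0"
      using lim by eventually_elim (auto intro!: tendsto_eq_intros)
    fix n
    show "AE x in lebesgue. norm ((norm (u n x - f x))\<^sup>2) \<le> 4 * (norm (w x))\<^sup>2"
      using fw le[of n]
    proof eventually_elim
      case (elim x)
      then have "norm (u n x - f x) \<le> 2 * norm (w x)"
        using norm_triangle_ineq4[of "u n x" "f x"] by simp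
      then have "(norm (u n x - f x))\<^sup>2 \<le> (2 * norm (w x))\<^sup>2" by (intro power_mono) auto
      then show ?case by (simp add: power_mult_distrib)
    qed
    show "(\<lambda>x. (norm (u n x - f x))\<^sup>2) \<in> borel_measurable lebesgue" using u f by measurable
  qed simp
  then show "(\<lambda>n. L2_norm (\<lambda>x. u n x - f x)) \<longlonglongrightarrow> 0"
    unfolding L2_norm_def by (auto intro!: tendsto_eq_intros)
qed

text \<open>Integrability of the limit is part of the conclusion, so the argument runs through
  \<open>nn_integral\<close>. The bound is required only eventually because completeness applies it
  to the tail of a subsequence.\<close>

lemma L2_Fatou:
  fixes g :: "'a::euclidean_space \<Rightarrow> complex"
  assumes u: "\<And>n. u n \<in> L2" and g: "g \<in> borel_measurable lebesgue"
    and lim: "AE x in lebesgue. (\<lambda>n. u n x) \<longlonglongrightarrow> g x"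
    and le: "eventually (\<lambda>n. L2_norm (u n) \<le> c) sequentially" and c: "0 \<le> c"
  shows "g \<in> L2" and "L2_norm g \<le> c"
proof -
  have "(\<integral>\<^sup>+x. ennreal ((norm (g x))\<^sup>2) \<partial>lebesgue) \<le> (\<integral>\<^sup>+x. liminf (\<lambda>n. ennreal ((norm (u n x))\<^sup>2)) \<partial>lebesgue)"
  proof (rule nn_integral_mono_AE)
    show "AE x in lebesgue. ennreal ((norm (g x))\<^sup>2) \<le> liminf (\<lambda>n. ennreal ((norm (u n x))\<^sup>2))"
      using lim
    proof eventually_elim
      case (elim x)
      then have "(\<lambda>n. ennreal ((norm (u n x))\<^sup>2)) \<longlonglongrightarrow> ennreal ((norm (g x))\<^sup>2)"
        by (intro tendsto_intros)
      from lim_imp_Liminf[OF sequentially_bot this] show ?case by (rule eq_refl[OF sym])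
    qed
  qed
  also have "\<dots> \<le> liminf (\<lambda>n. \<integral>\<^sup>+x. ennreal ((norm (u n x))\<^sup>2) \<partial>lebesgue)"
    using L2_measurable[OF u] by (intro nn_integral_liminf) measurable
  also have "(\<lambda>n. \<integral>\<^sup>+x. ennreal ((norm (u n x))\<^sup>2) \<partial>lebesgue) = (\<lambda>n. ennreal ((L2_norm (u n))\<^sup>2))"
    unfolding L2_norm_power2 using u by (intro ext nn_integral_eq_integral L2_integrable) auto
  also have "liminf (\<lambda>n. ennreal ((L2_norm (u n))\<^sup>2)) \<le> limsup (\<lambda>n. ennreal ((L2_norm (u n))\<^sup>2))"
    by (rule Liminf_le_Limsup) simp
  also have "\<dots> \<le> ennreal (c\<^sup>2)"
    using le by (intro Limsup_bounded) (auto elim!: eventually_mono intro!: ennreal_leI power_mono)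
  finally have *: "(\<integral>\<^sup>+x. ennreal ((norm (g x))\<^sup>2) \<partial>lebesgue) \<le> ennreal (c\<^sup>2)" .
  have "integrable lebesgue (\<lambda>x. (norm (g x))\<^sup>2)"
    using g * by (intro integrableI_nonneg) (auto simp: less_top[symmetric] top_unique)
  then show gL: "g \<in> L2" using g by (simp add: L2_def)
  have "ennreal ((L2_norm g)\<^sup>2) \<le> ennreal (c\<^sup>2)"
    using * unfolding L2_norm_power2 by (subst (asm) nn_integral_eq_integral) (auto intro: L2_integrable gL)
  then have "(L2_norm g)\<^sup>2 \<le> c\<^sup>2" by simp
  then show "L2_norm g \<le> c" using c by (rule power2_le_imp_le)
qed


section \<open>Affine changes of variables\<close>

lemma lborel_integrable_affine:
  fixes f :: "'a::euclidean_space \<Rightarrow> 'b::{banach, second_countable_topology}"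
  assumes f: "integrable lborel f" and c: "c \<noteq> 0"
  shows "integrable lborel (\<lambda>x. f (t + c *\<^sub>R x))"
proof -
  have [measurable]: "f \<in> borel_measurable borel" using f by auto
  have "integrable (density (distr lborel borel (\<lambda>x. t + c *\<^sub>R x)) (\<lambda>_. \<bar>c\<bar>^DIM('a))) f"
    using f lborel_affine[OF c, of t] by simp
  then have "integrable lborel (\<lambda>x. \<bar>c\<bar>^DIM('a) *\<^sub>R f (t + c *\<^sub>R x))"
    by (simp add: integrable_density integrable_distr_eq)
  then have "integrable lborel (\<lambda>x. (1 / \<bar>c\<bar>^DIM('a)) *\<^sub>R \<bar>c\<bar>^DIM('a) *\<^sub>R f (t + c *\<^sub>R x))"
    by (rule integrable_scaleR_right)
  with c show ?thesis by simp
qed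

lemma lborel_integral_affine:
  fixes f :: "'a::euclidean_space \<Rightarrow> 'b::{banach, second_countable_topology}"
  assumes [measurable]: "f \<in> borel_measurable borel" and c: "c \<noteq> 0"
  shows "(\<integral>x. f x \<partial>lborel) = \<bar>c\<bar>^DIM('a) *\<^sub>R (\<integral>x. f (t + c *\<^sub>R x) \<partial>lborel)"
  by (subst lborel_affine[OF c, of t]) (simp add: integral_density integral_distr)

section \<open>The Fourier transform of a Gaussian\<close>

text \<open>The factor \<open>pi\<close> makes this a fixed point of the Fourier transform with
  kernel \<open>cis (- 2 * pi * (x \<bullet> \<xi>))\<close>, and gives it total mass 1.\<close>

definition gauss :: "'a::euclidean_space \<Rightarrow> real" where
  "gauss x = exp (- pi * (norm x)\<^sup>2)"

lemma gauss_pos: "0 < gauss x" and gauss_nonneg [simp]: "0 \<le> gauss x"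
  and gauss_le_1: "gauss x \<le> 1" and gauss_uminus [simp]: "gauss (- x) = gauss x"
  by (simp_all add: gauss_def)

lemma borel_measurable_gauss [measurable]: "gauss \<in> borel_measurable borel"
  unfolding gauss_def[abs_def] by measurable

text \<open>Rescaling the standard normal density by \<open>sqrt (2 * pi)\<close> turns its exponent
  into \<open>- pi * x\<^sup>2\<close>, and the same factor cancels its normalization.\<close>

lemma integrable_gauss_real: "integrable lborel (\<lambda>x::real. exp (- pi * x\<^sup>2))"
proof -
  have "integrable lborel (\<lambda>x. std_normal_density (0 + sqrt (2 * pi) * x))"
    by (intro lborel_integrable_real_affine integrable_normal_density) auto
  then have "integrable lborel (\<lambda>x. sqrt (2 * pi) * std_normal_density (0 + sqrt (2 * pi) * x))"
    by simp
  also have "(\<lambda>x. sqrt (2 * pi) * std_normal_density (0 + sqrt (2 * pi) * x)) = (\<lambda>x. exp (- pi * x\<^sup>2))"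
    by (simp add: std_normal_density_def power_mult_distrib)
  finally show ?thesis .
qed

text \<open>This is the characteristic function \<open>exp (- s\<^sup>2 / 2)\<close> of the standard
  normal distribution at \<open>s = - sqrt (2 * pi) * t\<close>, after the same rescaling.\<close>

lemma fourier_gauss_real:
  "(\<integral>x. of_real (exp (- pi * x\<^sup>2)) * cis (- 2 * pi * (x * t)) \<partial>lborel) = of_real (exp (- pi * t\<^sup>2))"
proof -
  define s where "s = - sqrt (2 * pi) * t"
  have [measurable]: "(\<lambda>x. iexp (s * x)) \<in> borel_measurable borel"
    by (intro borel_measurable_continuous_onI continuous_intros)
  have "of_real (exp (- pi * t\<^sup>2)) = char std_normal_distribution s"
    by (simp add: char_std_normal_distribution s_def power_mult_distrib)
  also have "\<dots> = (\<integral>x. std_normal_density x *\<^sub>R iexp (s * x) \<partial>lborel)"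
    unfolding char_def by (subst integral_density) auto
  also have "\<dots> = sqrt (2 * pi) *\<^sub>R (\<integral>x. std_normal_density (0 + sqrt (2 * pi) * x) *\<^sub>R iexp (s * (0 + sqrt (2 * pi) * x)) \<partial>lborel)"
    by (subst lborel_integral_real_affine[where c = "sqrt (2 * pi)" and t = 0]) auto
  also have "\<dots> = (\<integral>x. sqrt (2 * pi) *\<^sub>R (std_normal_density (0 + sqrt (2 * pi) * x) *\<^sub>R iexp (s * (0 + sqrt (2 * pi) * x))) \<partial>lborel)"
    by (rule integral_scaleR_right[symmetric])
  also have "\<dots> = (\<integral>x. of_real (exp (- pi * x\<^sup>2)) * cis (- 2 * pi * (x * t)) \<partial>lborel)"
  proof (rule Bochner_Integration.integral_cong[OF refl])
    fix x :: real
    have "s * (0 + sqrt (2 * pi) * x) = - (sqrt (2 * pi) * sqrt (2 * pi)) * (x * t)"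
      unfolding s_def by (simp add: algebra_simps del: real_sqrt_mult_self)
    also have "\<dots> = - 2 * pi * (x * t)" by simp
    finally have 1: "s * (0 + sqrt (2 * pi) * x) = - 2 * pi * (x * t)" .
    have 2: "sqrt (2 * pi) * std_normal_density (0 + sqrt (2 * pi) * x) = exp (- pi * x\<^sup>2)"
      by (simp add: std_normal_density_def power_mult_distrib)
    show "sqrt (2 * pi) *\<^sub>R (std_normal_density (0 + sqrt (2 * pi) * x) *\<^sub>R iexp (s * (0 + sqrt (2 * pi) * x)))
        = of_real (exp (- pi * x\<^sup>2)) * cis (- 2 * pi * (x * t))"
      unfolding 1 scaleR_scaleR 2 by (simp add: cis_conv_exp scaleR_conv_of_real)
  qed
  finally show ?thesis by simp
qed

lemma cis_sum: "finite A \<Longrightarrow> cis (\<Sum>x\<in>A. f x) = (\<Prod>x\<in>A. cis (f x))"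
  by (induction A rule: finite_induct) (auto simp: cis_mult[symmetric])

lemma gauss_prod: "gauss (x::'a::euclidean_space) = (\<Prod>b\<in>Basis. exp (- pi * (x \<bullet> b)\<^sup>2))"
proof -
  have "(norm x)\<^sup>2 = (\<Sum>b\<in>Basis. (x \<bullet> b)\<^sup>2)"
    unfolding power2_norm_eq_inner by (subst euclidean_inner) (simp add: power2_eq_square)
  then show ?thesis by (simp add: gauss_def exp_sum[symmetric] sum_distrib_left sum_negf)
qed

text \<open>\<open>lborel\<close> is the image under \<open>T\<close> of the product of
  one-dimensional Lebesgue measures over the basis. The Gaussian and the character both factor over
  the coordinates, which reduces both claims to dimension one.\<close>

lemma
  fixes \<xi> :: "'a::euclidean_space"
  shows integrable_gauss: "integrable lborel (gauss :: 'a \<Rightarrow> real)"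
    and fourier_gauss: "(\<integral>x. of_real (gauss x) * cis (- 2 * pi * (x \<bullet> \<xi>)) \<partial>lborel) = of_real (gauss \<xi>)"
proof -
  interpret product_sigma_finite "\<lambda>_::'a. lborel :: real measure" ..
  define T :: "('a \<Rightarrow> real) \<Rightarrow> 'a" where "T = (\<lambda>f. \<Sum>b\<in>Basis. f b *\<^sub>R b)"
  have [measurable]: "T \<in> (\<Pi>\<^sub>M b\<in>Basis. lborel) \<rightarrow>\<^sub>M borel"
    unfolding T_def by measurable
  have T: "T f \<bullet> b = f b" if "b \<in> Basis" for f b
    using that by (simp add: T_def)
  have lb: "(lborel :: 'a measure) = distr (\<Pi>\<^sub>M b\<in>Basis. lborel) borel T"
    unfolding T_def by (rule lborel_eq)
  have "integrable (\<Pi>\<^sub>M b\<in>Basis. lborel) (\<lambda>f. \<Prod>b\<in>Basis. exp (- pi * (f (b::'a))\<^sup>2))"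
    by (intro product_integrable_prod integrable_gauss_real) simp
  also have "(\<lambda>f. \<Prod>b\<in>Basis. exp (- pi * (f (b::'a))\<^sup>2)) = (\<lambda>f. gauss (T f))"
    by (simp add: gauss_prod T)
  finally show "integrable lborel (gauss :: 'a \<Rightarrow> real)"
    by (simp add: lb integrable_distr_eq)
  have i: "integrable lborel (\<lambda>x. of_real (exp (- pi * x\<^sup>2)) * cis (- 2 * pi * (x * t)))" for t :: real
    by (rule Bochner_Integration.integrable_bound[OF integrable_gauss_real])
      (auto simp: norm_mult intro!: borel_measurable_continuous_onI continuous_intros)
  have [measurable]: "(\<lambda>x. of_real (gauss x) * cis (- 2 * pi * (x \<bullet> \<xi>))) \<in> borel_measurable borel"
    by (intro borel_measurable_times) (auto intro!: borel_measurable_continuous_onI continuous_intros)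
  have "(\<integral>x. of_real (gauss x) * cis (- 2 * pi * (x \<bullet> \<xi>)) \<partial>lborel)
      = (\<integral>f. of_real (gauss (T f)) * cis (- 2 * pi * (T f \<bullet> \<xi>)) \<partial>(\<Pi>\<^sub>M b\<in>Basis. lborel))"
    by (subst lb) (rule integral_distr; measurable)
  also have "(\<lambda>f. of_real (gauss (T f)) * cis (- 2 * pi * (T f \<bullet> \<xi>)))
      = (\<lambda>f. \<Prod>b\<in>Basis. of_real (exp (- pi * (f b)\<^sup>2)) * cis (- 2 * pi * (f b * (\<xi> \<bullet> b))))"
  proof
    fix f
    have "T f \<bullet> \<xi> = (\<Sum>b\<in>Basis. f b * (\<xi> \<bullet> b))"
      by (subst euclidean_inner) (simp add: T)
    then have "- 2 * pi * (T f \<bullet> \<xi>) = (\<Sum>b\<in>Basis. - 2 * pi * (f b * (\<xi> \<bullet> b)))"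
      by (simp add: sum_distrib_left sum_negf)
    then show "of_real (gauss (T f)) * cis (- 2 * pi * (T f \<bullet> \<xi>))
        = (\<Prod>b\<in>Basis. of_real (exp (- pi * (f b)\<^sup>2)) * cis (- 2 * pi * (f b * (\<xi> \<bullet> b))))"
      by (simp only: cis_sum finite_Basis prod.distrib gauss_prod of_real_prod) (simp add: T)
  qed
  also have "(\<integral>f. (\<Prod>b\<in>Basis. of_real (exp (- pi * (f b)\<^sup>2)) * cis (- 2 * pi * (f b * (\<xi> \<bullet> b)))) \<partial>(\<Pi>\<^sub>M b\<in>Basis. lborel))
      = (\<Prod>b\<in>Basis. of_real (exp (- pi * (\<xi> \<bullet> b)\<^sup>2)))"
    by (subst product_integral_prod[OF finite_Basis i]) (simp only: fourier_gauss_real)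
  also have "\<dots> = of_real (gauss \<xi>)" by (simp add: gauss_prod)
  finally show "(\<integral>x. of_real (gauss x) * cis (- 2 * pi * (x \<bullet> \<xi>)) \<partial>lborel) = of_real (gauss \<xi>)" .
qed

lemma integral_gauss: "(\<integral>x. gauss x \<partial>lborel) = 1"
proof -
  have "complex_of_real (\<integral>x. gauss (x::'a) \<partial>lborel) = 1"
    using fourier_gauss[of "0::'a"] by (simp add: gauss_def[of "0::'a"])
  then show ?thesis by (simp only: of_real_eq_1_iff)
qed

lemma borel_measurable_cis [measurable (raw)]:
  "f \<in> borel_measurable M \<Longrightarrow> (\<lambda>x. cis (f x)) \<in> borel_measurable M"
  by (rule measurable_compose[of f M borel cis])
    (auto intro!: borel_measurable_continuous_onI continuous_intros)

text \<open>A Gaussian of width \<open>1 / a\<close> in frequency corresponds to one of width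
  \<open>a\<close> in space. The factor \<open>1 / a ^ DIM('a)\<close> keeps the mass of the latter
  at 1, so that it is an approximate identity as \<open>a\<close> tends to 0.\<close>

lemma
  assumes a: "0 < a"
  shows integrable_gauss_scaled: "integrable lborel (\<lambda>\<xi>::'a::euclidean_space. gauss (a *\<^sub>R \<xi>))"
    and fourier_gauss_scaled: "(\<integral>\<xi>. of_real (gauss (a *\<^sub>R \<xi>)) * cis (- 2 * pi * (\<xi> \<bullet> z)) \<partial>lborel)
      = of_real (gauss ((1 / a) *\<^sub>R (z::'a)) / a ^ DIM('a))"
proof -
  show "integrable lborel (\<lambda>\<xi>::'a. gauss (a *\<^sub>R \<xi>))"
    using lborel_integrable_affine[OF integrable_gauss, of a 0] a by simp
  have "of_real (gauss ((1 / a) *\<^sub>R z)) = (\<integral>x. of_real (gauss x) * cis (- 2 * pi * (x \<bullet> ((1 / a) *\<^sub>R z))) \<partial>lborel)"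
    by (rule fourier_gauss[symmetric])
  also have "\<dots> = \<bar>a\<bar>^DIM('a) *\<^sub>R (\<integral>x. of_real (gauss (0 + a *\<^sub>R x)) * cis (- 2 * pi * ((0 + a *\<^sub>R x) \<bullet> ((1 / a) *\<^sub>R z))) \<partial>lborel)"
    using a by (intro lborel_integral_affine) auto
  also have "\<dots> = of_real (a ^ DIM('a)) * (\<integral>\<xi>. of_real (gauss (a *\<^sub>R \<xi>)) * cis (- 2 * pi * (\<xi> \<bullet> z)) \<partial>lborel)"
    using a by (simp add: scaleR_conv_of_real)
  finally show "(\<integral>\<xi>. of_real (gauss (a *\<^sub>R \<xi>)) * cis (- 2 * pi * (\<xi> \<bullet> z)) \<partial>lborel)
      = of_real (gauss ((1 / a) *\<^sub>R z) / a ^ DIM('a))"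
    using a by (simp add: field_simps)
qed


section \<open>Fourier integrals of integrable functions\<close>

lemma borel_imp_lebesgue [intro]:
  "f \<in> borel_measurable borel \<Longrightarrow> f \<in> borel_measurable lebesgue"
  by (simp add: measurable_completion)

text \<open>Passes from the completed measure of the definition to \<open>lborel\<close>, where
  Fubini's theorem and substitutions are applied; \<open>cis\<close> shows that the kernel has
  modulus 1.\<close>

lemma fourier_integral_lborel:
  fixes f :: "'a::euclidean_space \<Rightarrow> complex"
  assumes [measurable]: "f \<in> borel_measurable borel"
  shows "fourier_integral f \<xi> = (\<integral>x. f x * cis (- 2 * pi * (x \<bullet> \<xi>)) \<partial>lborel)"
proof -
  have e: "exp (- 2 * of_real pi * \<i> * of_real (x \<bullet> \<xi>)) = cis (- 2 * pi * (x \<bullet> \<xi>))" for x :: 'a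
    unfolding cis_conv_exp by (rule arg_cong[where f = exp]) simp
  show ?thesis
    unfolding fourier_integral_def e by (rule integral_completion) measurable
qed

lemma borel_measurable_fourier_integral [measurable]:
  fixes f :: "'a::euclidean_space \<Rightarrow> complex"
  assumes [measurable]: "f \<in> borel_measurable borel"
  shows "fourier_integral f \<in> borel_measurable borel"
proof -
  have "fourier_integral f = (\<lambda>\<xi>. \<integral>x. f x * cis (- 2 * pi * (x \<bullet> \<xi>)) \<partial>lborel)"
    by (rule ext) (rule fourier_integral_lborel[OF assms])
  also have "\<dots> \<in> borel_measurable borel"
    by measurable
  finally show ?thesis .
qed

lemma integrable_mult_cis:
  fixes f :: "'a::euclidean_space \<Rightarrow> complex"
  assumes f: "integrable lborel f" and [measurable]: "t \<in> borel_measurable borel"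
  shows "integrable lborel (\<lambda>x. f x * cis (t x))"
proof -
  have [measurable]: "f \<in> borel_measurable borel" using f by auto
  show ?thesis by (rule Bochner_Integration.integrable_bound[OF f]) (auto simp: norm_mult)
qed

lemma norm_fourier_integral_le:
  fixes f :: "'a::euclidean_space \<Rightarrow> complex"
  assumes f: "integrable lborel f"
  shows "norm (fourier_integral f \<xi>) \<le> (\<integral>x. norm (f x) \<partial>lborel)"
proof -
  have [measurable]: "f \<in> borel_measurable borel" using f by auto
  show ?thesis
    unfolding fourier_integral_lborel[OF \<open>f \<in> borel_measurable borel\<close>]
    using integral_norm_bound[of lborel "\<lambda>x. f x * cis (- 2 * pi * (x \<bullet> \<xi>))"]
    by (simp add: norm_mult)
qed

lemma integrable_mult_bounded:
  fixes f h :: "'a \<Rightarrow> complex"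
  assumes f: "integrable M f" and h: "h \<in> borel_measurable M" "\<And>x. norm (h x) \<le> B"
  shows "integrable M (\<lambda>x. h x * f x)"
proof (rule Bochner_Integration.integrable_bound)
  show "integrable M (\<lambda>x. B * norm (f x))" using f by simp
  show "(\<lambda>x. h x * f x) \<in> borel_measurable M"
    using f h by (intro borel_measurable_times) auto
  show "AE x in M. norm (h x * f x) \<le> norm (B * norm (f x))"
    using order_trans[OF norm_ge_zero h(2)] by (simp add: norm_mult h(2) mult_right_mono)
qed

text \<open>The kernel \<open>cis (- 2 * pi * (x \<bullet> y))\<close> is symmetric and of modulus
  1, so \<open>F\<close> is integrable over the product and Fubini's theorem exchanges the roles of
  \<open>f\<close> and \<open>g\<close>.\<close>

lemma fourier_multiplication_formula:
  fixes f g :: "'a::euclidean_space \<Rightarrow> complex"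
  assumes f: "integrable lborel f" and g: "integrable lborel g"
  shows "(\<integral>x. fourier_integral f x * g x \<partial>lborel) = (\<integral>x. f x * fourier_integral g x \<partial>lborel)"
proof -
  interpret lborel_pair: pair_sigma_finite "lborel :: 'a measure" "lborel :: 'a measure" ..
  have [measurable]: "f \<in> borel_measurable borel" "g \<in> borel_measurable borel" using f g by auto
  define F where "F = (\<lambda>x y. f x * g y * cis (- 2 * pi * (x \<bullet> y)))"
  have "integrable (lborel \<Otimes>\<^sub>M lborel) (case_prod F)"
  proof (rule lborel_pair.Fubini_integrable)
    show "case_prod F \<in> borel_measurable (lborel \<Otimes>\<^sub>M lborel)"
      unfolding F_def by measurable
    show "integrable lborel (\<lambda>x. \<integral>y. norm (case_prod F (x, y)) \<partial>lborel)"
      using f by (simp add: F_def norm_mult)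
    show "AE x in lborel. integrable lborel (\<lambda>y. case_prod F (x, y))"
      using g by (auto simp: F_def mult.assoc intro!: integrable_mult_right integrable_mult_cis)
  qed
  from lborel_pair.Fubini_integral[OF this]
  have "(\<integral>y. \<integral>x. F x y \<partial>lborel \<partial>lborel) = (\<integral>x. \<integral>y. F x y \<partial>lborel \<partial>lborel)" .
  moreover have "(\<integral>x. F x y \<partial>lborel) = fourier_integral f y * g y" for y
    by (simp add: F_def fourier_integral_lborel mult_ac flip: integral_mult_right_zero)
  moreover have "(\<integral>y. F x y \<partial>lborel) = f x * fourier_integral g x" for x
    by (simp add: F_def fourier_integral_lborel inner_commute mult_ac flip: integral_mult_right_zero)
  ultimately show ?thesis by simp
qed

section \<open>Translations, autocorrelation and the weighted energy identity\<close>

lemma translate_L2: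
  fixes f :: "'a::euclidean_space \<Rightarrow> complex"
  assumes [measurable]: "f \<in> borel_measurable borel" and f: "f \<in> L2"
  shows "(\<lambda>x. f (x - t)) \<in> L2" and "L2_norm (\<lambda>x. f (x - t)) = L2_norm f"
proof -
  have m: "(\<lambda>x. f (x - t)) \<in> borel_measurable borel" by measurable
  have "integrable lborel (\<lambda>x. (norm (f x))\<^sup>2)"
    using L2_integrable[OF f] by (simp add: integrable_completion)
  from lborel_integrable_affine[OF this, of 1 "- t"]
  have "integrable lborel (\<lambda>x. (norm (f (x - t)))\<^sup>2)" by simp
  then show "(\<lambda>x. f (x - t)) \<in> L2"
    using m by (auto simp: L2_def integrable_completion)
  have "(\<integral>x. (norm (f x))\<^sup>2 \<partial>lborel) = (\<integral>x. (norm (f (x - t)))\<^sup>2 \<partial>lborel)"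
    using lborel_integral_affine[of "\<lambda>x. (norm (f x))\<^sup>2" 1 "- t"] by simp
  then show "L2_norm (\<lambda>x. f (x - t)) = L2_norm f"
    by (simp add: L2_norm_def integral_completion)
qed

text \<open>The convolution of \<open>f\<close> with \<open>\<lambda>x. cnj (f (- x))\<close>;
  formally, its Fourier transform is the square modulus of that of \<open>f\<close>.\<close>

definition autocorr :: "('a::euclidean_space \<Rightarrow> complex) \<Rightarrow> 'a \<Rightarrow> complex" where
  "autocorr f t = (\<integral>x. f x * cnj (f (x - t)) \<partial>lborel)"

text \<open>Cauchy-Schwarz for \<open>f\<close> and its translate, which has the same norm. The
  bound on the integral of the modulus, uniform in \<open>t\<close>, is what Fubini's theorem needs
  in the energy identity.\<close>

lemma norm_autocorr_le:
  fixes f :: "'a::euclidean_space \<Rightarrow> complex"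
  assumes m[measurable]: "f \<in> borel_measurable borel" and f: "f \<in> L2"
  shows "integrable lborel (\<lambda>x. f x * cnj (f (x - t)))"
    and "(\<integral>x. norm (f x * cnj (f (x - t))) \<partial>lborel) \<le> (L2_norm f)\<^sup>2"
    and "norm (autocorr f t) \<le> (L2_norm f)\<^sup>2"
proof -
  note t = translate_L2[OF m f, of t]
  show *: "integrable lborel (\<lambda>x. f x * cnj (f (x - t)))"
    using integrable_L2_mult[OF f L2_cnj[OF t(1)]] by (simp add: integrable_completion)
  have "(\<integral>x. norm (f x) * norm (cnj (f (x - t))) \<partial>lebesgue) \<le> L2_norm f * L2_norm (\<lambda>x. f (x - t))"
    using L2_Cauchy_Schwarz[OF f L2_cnj[OF t(1)]] by (simp only: L2_norm_cnj)
  then show **: "(\<integral>x. norm (f x * cnj (f (x - t))) \<partial>lborel) \<le> (L2_norm f)\<^sup>2"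
    by (simp add: t norm_mult integral_completion power2_eq_square)
  show "norm (autocorr f t) \<le> (L2_norm f)\<^sup>2"
    unfolding autocorr_def by (rule order_trans[OF integral_norm_bound **])
qed

lemma borel_measurable_autocorr [measurable]:
  assumes [measurable]: "f \<in> borel_measurable borel"
  shows "autocorr f \<in> borel_measurable borel"
  unfolding autocorr_def by measurable

text \<open>A regularized inversion formula, with an average of \<open>f\<close> around
  \<open>x\<close> at scale \<open>a\<close> in place of the value \<open>f x\<close>. Up to
  conjugation it is the multiplication formula for \<open>f\<close> and a modulated
  Gaussian.\<close>

lemma fourier_gauss_average:
  fixes f :: "'a::euclidean_space \<Rightarrow> complex"
  assumes f: "integrable lborel f" and a: "0 < a"
  shows "fourier_integral (\<lambda>\<xi>. cnj (fourier_integral f \<xi>) * of_real (gauss (a *\<^sub>R \<xi>))) x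
    = (\<integral>u. cnj (f (x - a *\<^sub>R u)) * of_real (gauss u) \<partial>lborel)"
proof -
  have m[measurable]: "f \<in> borel_measurable borel" using f by auto
  \<comment> \<open>Modulation in frequency is translation in space: the transform of
    \<open>m\<close> is the Gaussian of width \<open>a\<close> centred at \<open>x\<close>.\<close>
  define m where "m \<xi> = complex_of_real (gauss (a *\<^sub>R \<xi>)) * cis (2 * pi * (\<xi> \<bullet> x))" for \<xi>
  have im: "integrable lborel m"
    unfolding m_def using integrable_gauss_scaled[OF a]
    by (intro integrable_mult_cis) (auto intro!: integrable_of_real)
  have [measurable]: "m \<in> borel_measurable borel" using im by auto
  have Fm: "fourier_integral m y = of_real (gauss ((1 / a) *\<^sub>R (y - x)) / a ^ DIM('a))" for y
  proof -
    have "fourier_integral m y = (\<integral>\<xi>. of_real (gauss (a *\<^sub>R \<xi>)) * cis (- 2 * pi * (\<xi> \<bullet> (y - x))) \<partial>lborel)"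
      unfolding fourier_integral_lborel[OF \<open>m \<in> borel_measurable borel\<close>] m_def
      by (simp add: cis_mult mult.assoc inner_diff_right right_diff_distrib)
    also have "\<dots> = of_real (gauss ((1 / a) *\<^sub>R (y - x)) / a ^ DIM('a))"
      by (rule fourier_gauss_scaled[OF a])
    finally show ?thesis .
  qed
  have "cnj (fourier_integral (\<lambda>\<xi>. cnj (fourier_integral f \<xi>) * of_real (gauss (a *\<^sub>R \<xi>))) x)
      = (\<integral>\<xi>. fourier_integral f \<xi> * m \<xi> \<partial>lborel)"
    by (subst fourier_integral_lborel[where f = "\<lambda>\<xi>. cnj (fourier_integral f \<xi>) * of_real (gauss (a *\<^sub>R \<xi>))"])
      (simp_all add: Bochner_Integration.integral_cnj[symmetric] m_def cis_cnj mult.assoc del: Bochner_Integration.integral_cnj)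
  also have "\<dots> = (\<integral>y. f y * of_real (gauss ((1 / a) *\<^sub>R (y - x)) / a ^ DIM('a)) \<partial>lborel)"
    using fourier_multiplication_formula[OF f im] by (simp only: Fm)
  \<comment> \<open>The substitution \<open>y = x - a *\<^sub>R u\<close> recentres the Gaussian at
    0; its Jacobian cancels the normalization.\<close>
  also have "\<dots> = \<bar>-a\<bar>^DIM('a) *\<^sub>R (\<integral>u. f (x + (- a) *\<^sub>R u) * of_real (gauss ((1 / a) *\<^sub>R (x + (- a) *\<^sub>R u - x)) / a ^ DIM('a)) \<partial>lborel)"
    using a by (intro lborel_integral_affine) auto
  also have "\<dots> = (\<integral>u. \<bar>-a\<bar>^DIM('a) *\<^sub>R (f (x + (- a) *\<^sub>R u) * of_real (gauss ((1 / a) *\<^sub>R (x + (- a) *\<^sub>R u - x)) / a ^ DIM('a))) \<partial>lborel)"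
    by (rule integral_scaleR_right[symmetric])
  also have "\<dots> = (\<integral>u. f (x - a *\<^sub>R u) * of_real (gauss u) \<partial>lborel)"
    using a by (simp add: scaleR_conv_of_real)
  finally have "cnj (fourier_integral (\<lambda>\<xi>. cnj (fourier_integral f \<xi>) * of_real (gauss (a *\<^sub>R \<xi>))) x)
      = (\<integral>u. f (x - a *\<^sub>R u) * of_real (gauss u) \<partial>lborel)" .
  from arg_cong[OF this, of cnj] show ?thesis
    by (simp add: Bochner_Integration.integral_cnj[symmetric] del: Bochner_Integration.integral_cnj)
qed

text \<open>The square modulus is the Fourier integral times its conjugate. With the Gaussian
  attached to the conjugate, the multiplication formula moves the transform onto that product, where
  it is the regularized inversion; Fubini's theorem turns the average of translates into one of the
  autocorrelation.\<close>

lemma fourier_energy_gauss: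
  fixes f :: "'a::euclidean_space \<Rightarrow> complex"
  assumes f: "integrable lborel f" and f2: "f \<in> L2" and a: "0 < a"
  shows "integrable lborel (\<lambda>\<xi>. (norm (fourier_integral f \<xi>))\<^sup>2 * gauss (a *\<^sub>R \<xi>))"
    and "of_real (\<integral>\<xi>. (norm (fourier_integral f \<xi>))\<^sup>2 * gauss (a *\<^sub>R \<xi>) \<partial>lborel)
      = (\<integral>u. of_real (gauss u) * autocorr f (a *\<^sub>R u) \<partial>lborel)"
proof -
  interpret lborel_pair: pair_sigma_finite "lborel :: 'a measure" "lborel :: 'a measure" ..
  have m[measurable]: "f \<in> borel_measurable borel" using f by auto
  define N where "N = (\<integral>x. norm (f x) \<partial>lborel)"
  have le: "norm (fourier_integral f \<xi>) \<le> N" for \<xi>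
    unfolding N_def by (rule norm_fourier_integral_le[OF f])
  define g where "g = (\<lambda>\<xi>. cnj (fourier_integral f \<xi>) * complex_of_real (gauss (a *\<^sub>R \<xi>)))"
  have g: "integrable lborel g"
    unfolding g_def
    by (rule integrable_mult_bounded[where B = N])
      (use integrable_gauss_scaled[OF a] le in \<open>auto intro!: integrable_of_real\<close>)
  have eq: "fourier_integral f \<xi> * g \<xi> = of_real ((norm (fourier_integral f \<xi>))\<^sup>2 * gauss (a *\<^sub>R \<xi>))" for \<xi>
    unfolding g_def of_real_mult complex_norm_square by simp
  have "integrable lborel (\<lambda>\<xi>. fourier_integral f \<xi> * g \<xi>)"
    by (rule integrable_mult_bounded[where B = N]) (use g le in auto)
  then show "integrable lborel (\<lambda>\<xi>. (norm (fourier_integral f \<xi>))\<^sup>2 * gauss (a *\<^sub>R \<xi>))"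
    unfolding eq complex_of_real_integrable_eq .
  define F where "F = (\<lambda>u x. f x * cnj (f (x - a *\<^sub>R u)) * complex_of_real (gauss u))"
  have F: "integrable (lborel \<Otimes>\<^sub>M lborel) (case_prod F)"
  proof (rule lborel_pair.Fubini_integrable)
    show "case_prod F \<in> borel_measurable (lborel \<Otimes>\<^sub>M lborel)"
      unfolding F_def by measurable
    show "AE u in lborel. integrable lborel (\<lambda>x. case_prod F (u, x))"
      using norm_autocorr_le(1)[OF m f2] by (auto simp: F_def)
    \<comment> \<open>Integration over \<open>x\<close> gives at most
      \<open>(L2_norm f)\<^sup>2\<close> for every \<open>u\<close>, so the Gaussian alone secures
      integrability in \<open>u\<close>.\<close>
    show "integrable lborel (\<lambda>u. \<integral>x. norm (case_prod F (u, x)) \<partial>lborel)"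
    proof (rule Bochner_Integration.integrable_bound)
      show "integrable lborel (\<lambda>u::'a. (L2_norm f)\<^sup>2 * gauss u)"
        by (intro integrable_mult_right integrable_gauss)
      show "(\<lambda>u. \<integral>x. norm (case_prod F (u, x)) \<partial>lborel) \<in> borel_measurable lborel"
        unfolding F_def by measurable
      show "AE u in lborel. norm (\<integral>x. norm (case_prod F (u, x)) \<partial>lborel) \<le> norm ((L2_norm f)\<^sup>2 * gauss u)"
      proof (rule AE_I2)
        fix u :: 'a
        have "(\<integral>x. norm (F u x) \<partial>lborel) = (\<integral>x. norm (f x * cnj (f (x - a *\<^sub>R u))) \<partial>lborel) * gauss u"
          by (simp add: F_def norm_mult)
        also have "\<dots> \<le> (L2_norm f)\<^sup>2 * gauss u"
          by (intro mult_right_mono norm_autocorr_le[OF m f2] gauss_nonneg)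
        finally show "norm (\<integral>x. norm (case_prod F (u, x)) \<partial>lborel) \<le> norm ((L2_norm f)\<^sup>2 * gauss u)"
          by simp
      qed
    qed
  qed
  have "of_real (\<integral>\<xi>. (norm (fourier_integral f \<xi>))\<^sup>2 * gauss (a *\<^sub>R \<xi>) \<partial>lborel)
      = (\<integral>\<xi>. fourier_integral f \<xi> * g \<xi> \<partial>lborel)"
    unfolding eq by (rule integral_complex_of_real[symmetric])
  also have "\<dots> = (\<integral>x. f x * fourier_integral g x \<partial>lborel)"
    by (rule fourier_multiplication_formula[OF f g])
  also have "\<dots> = (\<integral>x. \<integral>u. F u x \<partial>lborel \<partial>lborel)"
    unfolding g_def fourier_gauss_average[OF f a] F_def mult.assoc integral_mult_right_zero ..
  also have "\<dots> = (\<integral>u. \<integral>x. F u x \<partial>lborel \<partial>lborel)"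
    by (rule lborel_pair.Fubini_integral[OF F])
  also have "\<dots> = (\<integral>u. of_real (gauss u) * autocorr f (a *\<^sub>R u) \<partial>lborel)"
    by (simp add: F_def autocorr_def mult.commute)
  finally show "of_real (\<integral>\<xi>. (norm (fourier_integral f \<xi>))\<^sup>2 * gauss (a *\<^sub>R \<xi>) \<partial>lborel)
      = (\<integral>u. of_real (gauss u) * autocorr f (a *\<^sub>R u) \<partial>lborel)" .
qed


section \<open>Plancherel's theorem\<close>

lemma
  fixes f :: "'a::euclidean_space \<Rightarrow> complex"
  assumes f: "integrable lborel f" and f2: "f \<in> L2"
  shows fourier_integral_L2_borel: "fourier_integral f \<in> L2"
    and fourier_integral_contraction_borel: "L2_norm (fourier_integral f) \<le> L2_norm f"
proof -
  have m[measurable]: "f \<in> borel_measurable borel" using f by auto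
  define a where "a n = inverse (real (Suc n))" for n
  have a: "0 < a n" for n by (simp add: a_def)
  have a0: "a \<longlonglongrightarrow> 0" unfolding a_def by (rule LIMSEQ_inverse_real_of_nat)
  \<comment> \<open>The square root is chosen so that the squared norm carries exactly the weight of
    the energy identity.\<close>
  define u where "u n \<xi> = fourier_integral f \<xi> * of_real (sqrt (gauss (a n *\<^sub>R \<xi>)))" for n \<xi>
  have um: "u n \<in> borel_measurable borel" for n unfolding u_def by measurable
  have nu: "(norm (u n \<xi>))\<^sup>2 = (norm (fourier_integral f \<xi>))\<^sup>2 * gauss (a n *\<^sub>R \<xi>)" for n \<xi>
    by (simp add: u_def norm_mult power_mult_distrib)
  have u: "u n \<in> L2" for n
    using fourier_energy_gauss(1)[OF f f2 a[of n]] um[of n] by (auto simp: L2_def nu integrable_completion)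
  have "(L2_norm (u n))\<^sup>2 \<le> (L2_norm f)\<^sup>2" for n
  proof -
    have "(L2_norm (u n))\<^sup>2 = (\<integral>\<xi>. (norm (fourier_integral f \<xi>))\<^sup>2 * gauss (a n *\<^sub>R \<xi>) \<partial>lborel)"
      unfolding L2_norm_power2 nu by (rule integral_completion) measurable
    also have "\<dots> \<le> norm (complex_of_real \<dots>)" by simp
    also have "\<dots> \<le> (\<integral>u. norm (of_real (gauss u) * autocorr f (a n *\<^sub>R u)) \<partial>lborel)"
      unfolding fourier_energy_gauss(2)[OF f f2 a] by (rule integral_norm_bound)
    also have "\<dots> \<le> (\<integral>u. (L2_norm f)\<^sup>2 * gauss u \<partial>(lborel :: 'a measure))"
    proof (rule integral_mono_AE')
      show "integrable lborel (\<lambda>u::'a. (L2_norm f)\<^sup>2 * gauss u)"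
        by (intro integrable_mult_right integrable_gauss)
      show "AE u in lborel. norm (of_real (gauss u) * autocorr f (a n *\<^sub>R u)) \<le> (L2_norm f)\<^sup>2 * gauss u"
        by (intro AE_I2) (simp add: norm_mult mult.commute mult_left_mono norm_autocorr_le(3)[OF m f2])
    qed auto
    also have "\<dots> = (L2_norm f)\<^sup>2" using integral_gauss[where 'a='a] by simp
    finally show ?thesis .
  qed
  then have le: "L2_norm (u n) \<le> L2_norm f" for n
    by (rule power2_le_imp_le) simp
  have "(\<lambda>n. u n \<xi>) \<longlonglongrightarrow> fourier_integral f \<xi>" for \<xi>
  proof -
    have "(\<lambda>n. fourier_integral f \<xi> * of_real (sqrt (exp (- pi * (norm (a n *\<^sub>R \<xi>))\<^sup>2))))
        \<longlonglongrightarrow> fourier_integral f \<xi> * of_real (sqrt (exp (- pi * (norm (0 *\<^sub>R \<xi>))\<^sup>2)))"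
      by (intro tendsto_intros a0)
    then show ?thesis by (simp add: u_def gauss_def)
  qed
  then have lim: "AE \<xi> in lebesgue. (\<lambda>n. u n \<xi>) \<longlonglongrightarrow> fourier_integral f \<xi>" by simp
  have "fourier_integral f \<in> borel_measurable lebesgue" by (intro borel_imp_lebesgue) measurable
  note F = L2_Fatou[OF u this lim _ L2_norm_nonneg[of f]]
  show "fourier_integral f \<in> L2" "L2_norm (fourier_integral f) \<le> L2_norm f"
    by (rule F; use le in simp)+
qed

lemma autocorr_0:
  fixes f :: "'a::euclidean_space \<Rightarrow> complex"
  assumes [measurable]: "f \<in> borel_measurable borel"
  shows "autocorr f 0 = of_real ((L2_norm f)\<^sup>2)"
proof -
  have "autocorr f 0 = (\<integral>x. of_real ((norm (f x))\<^sup>2) \<partial>lborel)"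
    by (simp add: autocorr_def complex_norm_square del: of_real_power)
  also have "\<dots> = of_real ((L2_norm f)\<^sup>2)"
    unfolding L2_norm_power2 by (subst integral_complex_of_real) (simp add: integral_completion)
  finally show ?thesis .
qed

text \<open>Continuity at 0 lets the averages converge to \<open>autocorr f 0\<close>, the squared
  norm of \<open>f\<close>. On the frequency side the unweighted energy, finite by the contraction
  estimate, is the majorant.\<close>

lemma fourier_isometry_of_isCont_autocorr:
  fixes f :: "'a::euclidean_space \<Rightarrow> complex"
  assumes f: "integrable lborel f" and f2: "f \<in> L2" and cont: "isCont (autocorr f) 0"
  shows "L2_norm (fourier_integral f) = L2_norm f"
proof -
  have m[measurable]: "f \<in> borel_measurable borel" using f by auto
  define a where "a n = inverse (real (Suc n))" for n
  have a: "0 < a n" for n by (simp add: a_def)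
  have a0: "a \<longlonglongrightarrow> 0" unfolding a_def by (rule LIMSEQ_inverse_real_of_nat)
  have iF: "integrable lborel (\<lambda>\<xi>. (norm (fourier_integral f \<xi>))\<^sup>2)"
    using L2_integrable[OF fourier_integral_L2_borel[OF f f2]] by (simp add: integrable_completion)
  have "(\<lambda>n. \<integral>\<xi>. (norm (fourier_integral f \<xi>))\<^sup>2 * gauss (a n *\<^sub>R \<xi>) \<partial>lborel)
      \<longlonglongrightarrow> (\<integral>\<xi>. (norm (fourier_integral f \<xi>))\<^sup>2 \<partial>lborel)"
  proof (rule integral_dominated_convergence[OF _ _ iF])
    have "(\<lambda>n. (norm (fourier_integral f \<xi>))\<^sup>2 * exp (- pi * (norm (a n *\<^sub>R \<xi>))\<^sup>2))
        \<longlonglongrightarrow> (norm (fourier_integral f \<xi>))\<^sup>2 * exp (- pi * (norm (0 *\<^sub>R \<xi>))\<^sup>2)" for \<xi>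
      by (intro tendsto_intros a0)
    then show "AE \<xi> in lborel. (\<lambda>n. (norm (fourier_integral f \<xi>))\<^sup>2 * gauss (a n *\<^sub>R \<xi>))
        \<longlonglongrightarrow> (norm (fourier_integral f \<xi>))\<^sup>2"
      by (simp add: gauss_def)
    show "AE \<xi> in lborel. norm ((norm (fourier_integral f \<xi>))\<^sup>2 * gauss (a n *\<^sub>R \<xi>))
        \<le> (norm (fourier_integral f \<xi>))\<^sup>2" for n
      by (auto simp: abs_mult gauss_le_1 mult_left_le)
  qed measurable
  then have "(\<lambda>n. complex_of_real (\<integral>\<xi>. (norm (fourier_integral f \<xi>))\<^sup>2 * gauss (a n *\<^sub>R \<xi>) \<partial>lborel))
      \<longlonglongrightarrow> of_real (\<integral>\<xi>. (norm (fourier_integral f \<xi>))\<^sup>2 \<partial>lborel)"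
    by (rule tendsto_of_real)
  also have "(\<integral>\<xi>. (norm (fourier_integral f \<xi>))\<^sup>2 \<partial>lborel) = (L2_norm (fourier_integral f))\<^sup>2"
    unfolding L2_norm_power2 by (simp add: integral_completion)
  finally have 1: "(\<lambda>n. \<integral>u. of_real (gauss u) * autocorr f (a n *\<^sub>R u) \<partial>lborel)
      \<longlonglongrightarrow> of_real ((L2_norm (fourier_integral f))\<^sup>2)"
    by (simp only: fourier_energy_gauss(2)[OF f f2 a])
  have "(\<lambda>n. \<integral>u. of_real (gauss u) * autocorr f (a n *\<^sub>R u) \<partial>lborel)
      \<longlonglongrightarrow> (\<integral>u. of_real (gauss u) * autocorr f 0 \<partial>(lborel :: 'a measure))"
  proof (rule integral_dominated_convergence)
    show "integrable lborel (\<lambda>u::'a. (L2_norm f)\<^sup>2 * gauss u)"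
      by (intro integrable_mult_right integrable_gauss)
    show "AE u in lborel. norm (of_real (gauss u) * autocorr f (a n *\<^sub>R u)) \<le> (L2_norm f)\<^sup>2 * gauss u" for n
      by (intro AE_I2) (simp add: norm_mult mult.commute mult_left_mono norm_autocorr_le(3)[OF m f2])
    have "(\<lambda>n. autocorr f (a n *\<^sub>R u)) \<longlonglongrightarrow> autocorr f 0" for u
      by (rule isCont_tendsto_compose[OF cont]) (auto intro!: tendsto_eq_intros a0)
    then show "AE u in lborel. (\<lambda>n. of_real (gauss u) * autocorr f (a n *\<^sub>R u)) \<longlonglongrightarrow> of_real (gauss u) * autocorr f 0"
      by (auto intro!: tendsto_intros)
  qed measurable
  also have "(\<integral>u. of_real (gauss u) * autocorr f 0 \<partial>(lborel :: 'a measure)) = of_real (L2_norm f ^ 2)"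
    using integral_gauss[where 'a='a] autocorr_0[OF m] by simp
  finally have "complex_of_real ((L2_norm (fourier_integral f))\<^sup>2) = of_real (L2_norm f ^ 2)"
    by (rule LIMSEQ_unique[OF 1])
  then have "(L2_norm (fourier_integral f))\<^sup>2 = (L2_norm f)\<^sup>2"
    by (simp only: of_real_eq_iff)
  then show ?thesis by (simp add: power2_eq_iff_nonneg)
qed

section \<open>Continuous functions of compact support and their density\<close>

lemma
  fixes f :: "'a::euclidean_space \<Rightarrow> complex"
  assumes f: "f \<in> borel_measurable borel" and bd: "\<And>x. norm (f x) \<le> B"
    and supp: "\<And>x. R < norm x \<Longrightarrow> f x = 0"
  shows integrable_bounded_support: "integrable lborel f"
    and L2_bounded_support: "f \<in> L2"
proof -
  have i: "integrable lborel (\<lambda>x::'a. c * indicator (cball 0 R) x :: real)" for c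
    using emeasure_lborel_cball_finite[of "0::'a" R]
    by (intro integrable_mult_right integrable_real_indicator) auto
  show "integrable lborel f"
    by (rule Bochner_Integration.integrable_bound[OF i[of B]])
      (use f order_trans[OF bd abs_ge_self] supp in \<open>auto simp: indicator_def\<close>)
  have "integrable lborel (\<lambda>x. (norm (f x))\<^sup>2)"
    by (rule Bochner_Integration.integrable_bound[OF i[of "B\<^sup>2"]])
      (use f power_mono[OF bd norm_ge_zero, of _ 2] supp in \<open>auto simp: indicator_def\<close>)
  then show "f \<in> L2" using f by (auto simp: L2_def integrable_completion)
qed

text \<open>Boundedness of \<open>f\<close> yields the majorant \<open>B * norm (f x)\<close>,
  independent of the shift, so dominated convergence makes the autocorrelation continuous at
  0.\<close>

lemma fourier_isometry_compact_support:
  fixes f :: "'a::euclidean_space \<Rightarrow> complex"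
  assumes f: "continuous_on UNIV f" and supp: "\<And>x. R < norm x \<Longrightarrow> f x = 0"
  shows "integrable lborel f" "f \<in> L2" "L2_norm (fourier_integral f) = L2_norm f"
proof -
  have m[measurable]: "f \<in> borel_measurable borel" by (rule borel_measurable_continuous_onI[OF f])
  have "bounded (f ` cball 0 R)"
    by (intro compact_imp_bounded compact_continuous_image continuous_on_subset[OF f]) auto
  then obtain B where B: "0 < B" "\<And>x. x \<in> cball 0 R \<Longrightarrow> norm (f x) \<le> B"
    by (auto simp: bounded_pos)
  have bd: "norm (f x) \<le> B" for x
    using B(1) B(2)[of x] supp[of x] by (cases "norm x \<le> R") auto
  show i: "integrable lborel f" and f2: "f \<in> L2"
    using integrable_bounded_support[OF m bd supp] L2_bounded_support[OF m bd supp] by auto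
  have "isCont (autocorr f) 0"
    unfolding continuous_at_sequentially
  proof (intro allI impI)
    fix t :: "nat \<Rightarrow> 'a" assume t: "t \<longlonglongrightarrow> 0"
    have "(\<lambda>n. autocorr f (t n)) \<longlonglongrightarrow> autocorr f 0"
      unfolding autocorr_def
    proof (rule integral_dominated_convergence)
      show "integrable lborel (\<lambda>x. B * norm (f x))" using i by simp
      have "(\<lambda>n. f (x - t n)) \<longlonglongrightarrow> f (x - 0)" for x
        by (rule continuous_on_tendsto_compose[OF f tendsto_diff[OF tendsto_const t]]) auto
      then show "AE x in lborel. (\<lambda>n. f x * cnj (f (x - t n))) \<longlonglongrightarrow> f x * cnj (f (x - 0))"
        by (auto intro!: tendsto_intros)
      show "AE x in lborel. norm (f x * cnj (f (x - t n))) \<le> B * norm (f x)" for n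
        using bd by (auto simp: norm_mult mult.commute[of B] intro!: mult_left_mono)
    qed measurable
    then show "(autocorr f \<circ> t) \<longlonglongrightarrow> autocorr f 0" by (simp add: o_def)
  qed
  then show "L2_norm (fourier_integral f) = L2_norm f"
    by (rule fourier_isometry_of_isCont_autocorr[OF i f2])
qed

text \<open>A measurable function is an almost everywhere limit of continuous ones, but neither
  their size nor their support is controlled. Therefore \<open>f\<close> is replaced by
  \<open>fn n\<close>, cut in size and support, and continuous versions of the same cuts are applied
  to the approximants: the limit stays the same, and \<open>w\<close> becomes a common
  majorant.\<close>

lemma L2_approx_continuous:
  fixes f :: "'a::euclidean_space \<Rightarrow> complex"
  assumes f: "f \<in> L2" and e: "0 < e"
  obtains g R where "continuous_on UNIV g" "\<And>x. R < norm x \<Longrightarrow> g x = 0" "L2_norm (\<lambda>x. f x - g x) < e"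
proof -
  have [measurable]: "f \<in> borel_measurable lebesgue" using f by (rule L2_measurable)
  have [measurable]: "(\<lambda>x::'a. norm x) \<in> borel_measurable lebesgue" by (intro borel_imp_lebesgue) measurable
  define fn where "fn n x = (if norm x \<le> real n \<and> norm (f x) \<le> real n then f x else 0)" for n x
  have fnm: "fn n \<in> borel_measurable lebesgue" for n
    unfolding fn_def by measurable
  have "(\<lambda>n. L2_norm (\<lambda>x. fn n x - f x)) \<longlonglongrightarrow> 0"
  proof (rule L2_dominated_convergence[OF f L2_measurable[OF f] fnm])
    show "AE x in lebesgue. norm (fn n x) \<le> norm (f x)" for n
      by (simp add: fn_def)
    have "(\<lambda>n. fn n x) \<longlonglongrightarrow> f x" for x
    proof (rule tendsto_eventually)
      have "\<forall>\<^sub>F n in sequentially. max (norm x) (norm (f x)) \<le> real n"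
        by real_asymp
      then show "\<forall>\<^sub>F n in sequentially. fn n x = f x"
        by eventually_elim (simp add: fn_def)
    qed
    then show "AE x in lebesgue. (\<lambda>n. fn n x) \<longlonglongrightarrow> f x" by simp
  qed
  then have "\<forall>\<^sub>F n in sequentially. L2_norm (\<lambda>x. fn n x - f x) < e / 2"
    using e by (intro order_tendstoD) auto
  then obtain n where n: "L2_norm (\<lambda>x. fn n x - f x) < e / 2"
    by (auto simp: eventually_sequentially)
  have fn2: "fn n \<in> L2" by (rule L2_dominated[OF f fnm]) (simp add: fn_def)
  have "fn n measurable_on UNIV"
    using fnm by (intro lebesgue_measurable_imp_measurable_on) auto
  then obtain N g where N: "negligible N" and g: "\<And>k. continuous_on UNIV (g k)"
    and lim: "\<And>x. x \<notin> N \<Longrightarrow> (\<lambda>k. g k x) \<longlonglongrightarrow> fn n x"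
    unfolding measurable_on_def by auto
  \<comment> \<open>The nearest-point projection onto the disc is continuous and fixes the values of
    \<open>fn n\<close>, so it clips without a jump.\<close>
  define c where "c = closest_point (cball (0::complex) (real n))"
  have c: "continuous_on UNIV c" "\<And>z. norm (c z) \<le> real n" "\<And>z. norm z \<le> real n \<Longrightarrow> c z = z"
    using continuous_on_closest_point[of "cball (0::complex) (real n)" UNIV]
      closest_point_in_set[of "cball (0::complex) (real n)"]
      closest_point_self[of _ "cball (0::complex) (real n)"]
    by (auto simp: c_def)
  \<comment> \<open>Equal to 1 wherever \<open>fn n\<close> can be nonzero, with a linear descent
    between the radii \<open>n\<close> and \<open>n + 1\<close>.\<close>
  define ct :: "'a \<Rightarrow> real" where "ct x = max 0 (min 1 (real n + 1 - norm x))" for x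
  have ct: "continuous_on UNIV ct" "\<And>x. \<bar>ct x\<bar> \<le> 1" "\<And>x. norm x \<le> real n \<Longrightarrow> ct x = 1"
     "\<And>x. real n + 1 < norm x \<Longrightarrow> ct x = 0"
    unfolding ct_def by (auto intro!: continuous_intros)
  define h where "h k x = of_real (ct x) * c (g k x)" for k x
  have hc: "continuous_on UNIV (h k)" for k
    unfolding h_def
    by (intro continuous_intros ct continuous_on_compose2[OF c(1) g]) auto
  have hsupp: "h k x = 0" if "real n + 1 < norm x" for k x
    using ct(4)[OF that] by (simp add: h_def)
  define w where "w = (\<lambda>x::'a. complex_of_real (real n) * indicator (cball 0 (real n + 1)) x)"
  have w: "w \<in> L2"
    by (rule L2_bounded_support[where B = "real n" and R = "real n + 1"]) (auto simp: w_def indicator_def)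
  have hw: "norm (h k x) \<le> norm (w x)" for k x
    using mult_mono[OF ct(2)[of x] c(2)[of "g k x"]] hsupp[of x k]
    by (cases "norm x \<le> real n + 1") (auto simp: h_def w_def norm_mult)
  have "(\<lambda>k. L2_norm (\<lambda>x. h k x - fn n x)) \<longlonglongrightarrow> 0"
  proof (rule L2_dominated_convergence[OF w fnm])
    show "h k \<in> borel_measurable lebesgue" for k
      by (intro borel_imp_lebesgue borel_measurable_continuous_onI hc)
    have "(\<lambda>k. h k x) \<longlonglongrightarrow> fn n x" if "x \<notin> N" for x
    proof -
      have "(\<lambda>k. c (g k x)) \<longlonglongrightarrow> c (fn n x)"
        by (rule continuous_on_tendsto_compose[OF c(1) lim[OF that]]) auto
      also have "c (fn n x) = fn n x" by (rule c(3)) (simp add: fn_def)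
      finally have "(\<lambda>k. h k x) \<longlonglongrightarrow> of_real (ct x) * fn n x"
        unfolding h_def by (intro tendsto_intros)
      also have "of_real (ct x) * fn n x = fn n x"
        using ct(3)[of x] by (auto simp: fn_def)
      finally show ?thesis .
    qed
    moreover have "AE x in lebesgue. x \<notin> N"
      using N by (intro AE_not_in) (simp add: negligible_iff_null_sets)
    ultimately show "AE x in lebesgue. (\<lambda>k. h k x) \<longlonglongrightarrow> fn n x"
      by (auto elim!: eventually_mono)
    show "AE x in lebesgue. norm (h k x) \<le> norm (w x)" for k using hw by simp
  qed
  then have "\<forall>\<^sub>F k in sequentially. L2_norm (\<lambda>x. h k x - fn n x) < e / 2"
    using e by (intro order_tendstoD) auto
  then obtain k where k: "L2_norm (\<lambda>x. h k x - fn n x) < e / 2"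
    by (auto simp: eventually_sequentially)
  have "L2_norm (\<lambda>x. f x - h k x) \<le> L2_norm (\<lambda>x. f x - fn n x) + L2_norm (\<lambda>x. fn n x - h k x)"
    using hsupp by (intro L2_norm_diff_triangle f fn2 fourier_isometry_compact_support(2)[OF hc, of "real n + 1"])
  also have "\<dots> < e"
    using n k by (simp add: L2_norm_minus_commute[of f "fn n"] L2_norm_minus_commute[of "fn n" "h k"])
  finally show thesis using hsupp by (intro that[OF hc, of "real n + 1" k])
qed

lemma fourier_integral_diff_borel:
  fixes f g :: "'a::euclidean_space \<Rightarrow> complex"
  assumes f: "integrable lborel f" and g: "integrable lborel g"
  shows "fourier_integral (\<lambda>x. f x - g x) \<xi> = fourier_integral f \<xi> - fourier_integral g \<xi>"
proof -
  have [measurable]: "f \<in> borel_measurable borel" "g \<in> borel_measurable borel" using f g by auto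
  show ?thesis
    using integrable_mult_cis[OF f, of "\<lambda>x. - 2 * pi * (x \<bullet> \<xi>)"]
      integrable_mult_cis[OF g, of "\<lambda>x. - 2 * pi * (x \<bullet> \<xi>)"]
    by (simp add: fourier_integral_lborel left_diff_distrib)
qed

lemma fourier_isometry_borel:
  fixes f :: "'a::euclidean_space \<Rightarrow> complex"
  assumes f: "integrable lborel f" and f2: "f \<in> L2"
  shows "L2_norm (fourier_integral f) = L2_norm f"
proof (rule antisym[OF fourier_integral_contraction_borel[OF f f2]])
  \<comment> \<open>The approximation error enters twice: in space, and again in frequency through
    the contraction estimate.\<close>
  have "L2_norm f \<le> L2_norm (fourier_integral f) + 2 * e" if "0 < e" for e
  proof -
    obtain g R where g: "continuous_on UNIV g" "\<And>x. R < norm x \<Longrightarrow> g x = 0"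
      and fg: "L2_norm (\<lambda>x. f x - g x) < e"
      using L2_approx_continuous[OF f2 \<open>0 < e\<close>] by blast
    have g: "integrable lborel g" "g \<in> L2" "L2_norm (fourier_integral g) = L2_norm g"
      by (rule fourier_isometry_compact_support[OF g(1), of R]; use g(2) in simp)+
    have gf: "integrable lborel (\<lambda>x. g x - f x)" "(\<lambda>x. g x - f x) \<in> L2"
      using f f2 g by (auto intro: L2_diff)
    have "L2_norm f \<le> L2_norm (\<lambda>x. f x - g x) + L2_norm g"
      by (rule L2_norm_diff_ineq[OF f2 g(2)])
    also have "L2_norm g = L2_norm (fourier_integral g)" using g(3) by simp
    also have "\<dots> \<le> L2_norm (\<lambda>\<xi>. fourier_integral g \<xi> - fourier_integral f \<xi>) + L2_norm (fourier_integral f)"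
      by (intro L2_norm_diff_ineq fourier_integral_L2_borel f f2 g)
    also have "L2_norm (\<lambda>\<xi>. fourier_integral g \<xi> - fourier_integral f \<xi>) = L2_norm (fourier_integral (\<lambda>x. g x - f x))"
      by (intro arg_cong[where f = L2_norm] ext fourier_integral_diff_borel[symmetric] g f)
    also have "\<dots> \<le> L2_norm (\<lambda>x. g x - f x)"
      by (rule fourier_integral_contraction_borel[OF gf])
    also have "\<dots> = L2_norm (\<lambda>x. f x - g x)" by (rule L2_norm_minus_commute)
    finally show ?thesis using fg by simp
  qed
  note * = this
  show "L2_norm f \<le> L2_norm (fourier_integral f)"
  proof (rule field_le_epsilon)
    fix e :: real assume "0 < e"
    with *[of "e / 2"] show "L2_norm f \<le> L2_norm (fourier_integral f) + e" by simp
  qed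
qed


section \<open>Transfer from Borel to Lebesgue measurable functions\<close>

lemma borel_representative:
  fixes f :: "'a::euclidean_space \<Rightarrow> complex"
  assumes [measurable]: "f \<in> borel_measurable lebesgue"
  obtains f' where "f' \<in> borel_measurable borel" "AE x in lebesgue. f x = f' x"
proof -
  have "(\<lambda>x. Re (f x)) \<in> borel_measurable lebesgue" "(\<lambda>x. Im (f x)) \<in> borel_measurable lebesgue"
    by measurable
  from this[THEN completion_ex_borel_measurable_real] obtain a b
    where ab: "a \<in> borel_measurable lborel" "b \<in> borel_measurable lborel"
      "AE x in lborel. Re (f x) = a x" "AE x in lborel. Im (f x) = b x"
    by auto
  show thesis
  proof
    show "(\<lambda>x. Complex (a x) (b x)) \<in> borel_measurable borel"
      using ab(1,2) unfolding Complex_eq by simp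
    have "AE x in lborel. f x = Complex (a x) (b x)"
      using ab(3,4) by eventually_elim (simp add: complex_eq_iff)
    then show "AE x in lebesgue. f x = Complex (a x) (b x)" by (rule AE_completion)
  qed
qed

text \<open>Each value is an integral and thus blind to null sets, so the agreement is at every
  frequency. This allows a Borel representative to replace \<open>f\<close>.\<close>

lemma fourier_integral_cong_AE:
  fixes f g :: "'a::euclidean_space \<Rightarrow> complex"
  assumes [measurable]: "f \<in> borel_measurable lebesgue" "g \<in> borel_measurable lebesgue"
    and eq: "AE x in lebesgue. f x = g x"
  shows "fourier_integral f = fourier_integral g"
proof
  fix \<xi> :: 'a
  have [measurable]: "(\<lambda>x. exp (- 2 * of_real pi * \<i> * of_real (x \<bullet> \<xi>))) \<in> borel_measurable lebesgue"
    by (intro borel_imp_lebesgue borel_measurable_continuous_onI continuous_intros)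
  show "fourier_integral f \<xi> = fourier_integral g \<xi>"
    unfolding fourier_integral_def using eq
    by (intro integral_cong_AE) (measurable, auto elim!: eventually_mono)
qed

lemma L2_borel_representative:
  fixes f :: "'a::euclidean_space \<Rightarrow> complex"
  assumes f: "integrable lebesgue f" and f2: "f \<in> L2"
  obtains f' where "integrable lborel f'" "f' \<in> L2" "AE x in lebesgue. f x = f' x"
    "fourier_integral f' = fourier_integral f" "L2_norm f' = L2_norm f"
proof -
  have m: "f \<in> borel_measurable lebesgue" using f2 by (rule L2_measurable)
  obtain f' where f': "f' \<in> borel_measurable borel" "AE x in lebesgue. f x = f' x"
    by (rule borel_representative[OF m])
  have m': "f' \<in> borel_measurable lebesgue" using f'(1) by (rule borel_imp_lebesgue)
  have n: "AE x in lebesgue. norm (f x) = norm (f' x)" using f'(2) by (auto elim!: eventually_mono)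
  have "integrable lebesgue f'" using integrable_cong_AE[OF m m' f'(2)] f by simp
  then have "integrable lborel f'" using f'(1) by (simp add: integrable_completion)
  then show thesis
    using L2_cong_AE[OF f2 m' n] f'(2) fourier_integral_cong_AE[OF m m' f'(2)] L2_norm_cong_AE[OF m m' n]
    by (intro that) simp_all
qed

lemma
  fixes f :: "'a::euclidean_space \<Rightarrow> complex"
  assumes f: "integrable lebesgue f" and f2: "f \<in> L2"
  shows fourier_integral_L2: "fourier_integral f \<in> L2"
    and fourier_integral_isometry: "L2_norm (fourier_integral f) = L2_norm f"
proof -
  obtain f' where f': "integrable lborel f'" "f' \<in> L2"
    "fourier_integral f' = fourier_integral f" "L2_norm f' = L2_norm f"
    by (rule L2_borel_representative[OF f f2])
  show "fourier_integral f \<in> L2" "L2_norm (fourier_integral f) = L2_norm f"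
    using fourier_integral_L2_borel[OF f'(1,2)] fourier_isometry_borel[OF f'(1,2)] f'(3,4) by simp_all
qed

lemma fourier_integral_diff:
  fixes f g :: "'a::euclidean_space \<Rightarrow> complex"
  assumes f: "integrable lebesgue f" "f \<in> L2" and g: "integrable lebesgue g" "g \<in> L2"
  shows "fourier_integral (\<lambda>x. f x - g x) \<xi> = fourier_integral f \<xi> - fourier_integral g \<xi>"
proof -
  obtain f' where f': "integrable lborel f'" "f' \<in> L2" "AE x in lebesgue. f x = f' x"
    "fourier_integral f' = fourier_integral f"
    by (rule L2_borel_representative[OF f])
  obtain g' where g': "integrable lborel g'" "g' \<in> L2" "AE x in lebesgue. g x = g' x"
    "fourier_integral g' = fourier_integral g"
    by (rule L2_borel_representative[OF g])
  have "fourier_integral (\<lambda>x. f x - g x) = fourier_integral (\<lambda>x. f' x - g' x)"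
  proof (rule fourier_integral_cong_AE)
    show "AE x in lebesgue. f x - g x = f' x - g' x" using f'(3) g'(3) by eventually_elim simp
  qed (use f g f' g' in \<open>auto intro!: L2_measurable L2_diff\<close>)
  then show ?thesis using fourier_integral_diff_borel[OF f'(1) g'(1)] f'(4) g'(4) by simp
qed

lemma fourier_multiplication_formula_lebesgue:
  fixes f g :: "'a::euclidean_space \<Rightarrow> complex"
  assumes f: "integrable lebesgue f" "f \<in> L2" and g: "integrable lebesgue g" "g \<in> L2"
  shows "(\<integral>x. fourier_integral f x * g x \<partial>lebesgue) = (\<integral>x. f x * fourier_integral g x \<partial>lebesgue)"
proof -
  obtain f' where f': "integrable lborel f'" "f' \<in> L2" "AE x in lebesgue. f x = f' x"
    "fourier_integral f' = fourier_integral f"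
    by (rule L2_borel_representative[OF f])
  obtain g' where g': "integrable lborel g'" "g' \<in> L2" "AE x in lebesgue. g x = g' x"
    "fourier_integral g' = fourier_integral g"
    by (rule L2_borel_representative[OF g])
  have m[measurable]: "f' \<in> borel_measurable borel" "g' \<in> borel_measurable borel" using f'(1) g'(1) by auto
  note lm = L2_measurable[OF f(2)] L2_measurable[OF g(2)] borel_imp_lebesgue[OF m(1)] borel_imp_lebesgue[OF m(2)]
     L2_measurable[OF fourier_integral_L2[OF f]] L2_measurable[OF fourier_integral_L2[OF g]]
  have "(\<integral>x. fourier_integral f x * g x \<partial>lebesgue) = (\<integral>x. fourier_integral f' x * g' x \<partial>lebesgue)"
    unfolding f'(4) using g'(3) lm
    by (intro integral_cong_AE borel_measurable_times) (auto elim!: eventually_mono)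
  also have "\<dots> = (\<integral>x. fourier_integral f' x * g' x \<partial>lborel)"
    by (rule integral_completion) measurable
  also have "\<dots> = (\<integral>x. f' x * fourier_integral g' x \<partial>lborel)"
    by (rule fourier_multiplication_formula[OF f'(1) g'(1)])
  also have "\<dots> = (\<integral>x. f' x * fourier_integral g' x \<partial>lebesgue)"
    by (rule integral_completion[symmetric]) measurable
  also have "\<dots> = (\<integral>x. f x * fourier_integral g x \<partial>lebesgue)"
    unfolding g'(4) using f'(3) lm
    by (intro integral_cong_AE borel_measurable_times) (auto elim!: eventually_mono)
  finally show ?thesis .
qed

section \<open>Completeness of \<open>L\<^sup>2\<close>\<close>

text \<open>The limit is taken pointwise along an almost everywhere convergent subsequence. Fatou's
  lemma for \<open>u i - u (r k)\<close> as \<open>k\<close> grows turns the Cauchy bound into a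
  bound on the distance to \<open>g\<close> for every late \<open>i\<close>, hence for the whole
  sequence.\<close>

lemma L2_complete:
  fixes u :: "nat \<Rightarrow> 'a::euclidean_space \<Rightarrow> complex"
  assumes u: "\<And>n. u n \<in> L2"
    and C: "\<And>e. 0 < e \<Longrightarrow> \<exists>N. \<forall>i\<ge>N. \<forall>j\<ge>N. L2_norm (\<lambda>x. u i x - u j x) < e"
  obtains g where "g \<in> L2" "(\<lambda>n. L2_norm (\<lambda>x. u n x - g x)) \<longlonglongrightarrow> 0"
proof -
  define w where "w = (\<lambda>x::'a. complex_of_real (gauss x))"
  \<comment> \<open>A strictly positive weight in \<open>L\<^sup>2\<close> turns Cauchy sequences in \<open>L\<^sup>2\<close> into Cauchy sequences in \<open>L\<^sup>1\<close>.\<close>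
  have w: "w \<in> L2"
  proof -
    have "integrable lborel (\<lambda>x::'a. (norm (w x))\<^sup>2)"
      by (rule Bochner_Integration.integrable_bound[OF integrable_gauss])
        (auto simp: w_def power2_eq_square gauss_le_1 mult_left_le)
    moreover have "w \<in> borel_measurable borel" unfolding w_def by measurable
    ultimately show ?thesis by (auto simp: L2_def integrable_completion)
  qed
  define s where "s n x = w x * u n x" for n x
  have s: "integrable lebesgue (s n)" for n
    unfolding s_def by (rule integrable_L2_mult[OF w u])
  have "\<exists>N. \<forall>i\<ge>N. \<forall>j\<ge>N. (\<integral>x. norm (s i x - s j x) \<partial>lebesgue) < e" if "0 < e" for e
  proof -
    \<comment> \<open>The summand 1 keeps the denominator positive without any lower bound on
      \<open>L2_norm w\<close>.\<close>
    from \<open>0 < e\<close> have "0 < e / (L2_norm w + 1)" by (simp add: add_nonneg_pos)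
    from C[OF this] obtain N where N: "\<And>i j. i \<ge> N \<Longrightarrow> j \<ge> N \<Longrightarrow> L2_norm (\<lambda>x. u i x - u j x) < e / (L2_norm w + 1)"
      by blast
    have "(\<integral>x. norm (s i x - s j x) \<partial>lebesgue) < e" if "i \<ge> N" "j \<ge> N" for i j
    proof -
      have "(\<integral>x. norm (s i x - s j x) \<partial>lebesgue) = (\<integral>x. norm (w x) * norm (u i x - u j x) \<partial>lebesgue)"
        by (simp add: s_def norm_mult flip: right_diff_distrib)
      also have "\<dots> \<le> L2_norm w * L2_norm (\<lambda>x. u i x - u j x)"
        by (rule L2_Cauchy_Schwarz[OF w L2_diff[OF u u]])
      also have "\<dots> \<le> (L2_norm w + 1) * L2_norm (\<lambda>x. u i x - u j x)"
        by (intro mult_right_mono) auto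
      also have "\<dots> < e"
        using N[OF that] pos_less_divide_eq[of "L2_norm w + 1" "L2_norm (\<lambda>x. u i x - u j x)" e]
        by (simp add: add_nonneg_pos mult.commute)
      finally show ?thesis .
    qed
    then show ?thesis by blast
  qed
  from cauchy_L1_AE_cauchy_subseq[OF s this] obtain r :: "nat \<Rightarrow> nat" where r: "strict_mono r"
    and Cr: "AE x in lebesgue. Cauchy (\<lambda>i. s (r i) x)" by blast
  define g where "g x = lim (\<lambda>i. u (r i) x)" for x
  have gm: "g \<in> borel_measurable lebesgue"
    unfolding g_def by (rule borel_measurable_lim_metric[OF L2_measurable[OF u]])
  have lim: "AE x in lebesgue. (\<lambda>i. u (r i) x) \<longlonglongrightarrow> g x"
    using Cr
  proof eventually_elim
    case (elim x)
    then obtain l where "(\<lambda>i. s (r i) x) \<longlonglongrightarrow> l"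
      by (auto simp: Cauchy_convergent_iff convergent_def)
    then have "(\<lambda>i. s (r i) x / w x) \<longlonglongrightarrow> l / w x"
      by (intro tendsto_divide tendsto_const) (use gauss_pos[of x] in \<open>auto simp: w_def\<close>)
    also have "(\<lambda>i. s (r i) x / w x) = (\<lambda>i. u (r i) x)"
      using gauss_pos[of x] by (simp add: s_def w_def)
    finally show ?case
      unfolding g_def by (metis convergentI convergent_LIMSEQ_iff)
  qed
  have *: "(\<lambda>x. u i x - g x) \<in> L2" "L2_norm (\<lambda>x. u i x - g x) \<le> e"
    if N: "\<forall>i\<ge>N. \<forall>j\<ge>N. L2_norm (\<lambda>x. u i x - u j x) < e" and i: "i \<ge> N" for i N e
  proof -
    have e: "0 \<le> e" using N i L2_norm_nonneg[of "\<lambda>x. u i x - u i x"] by (meson less_imp_le order_trans)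
    have ev: "\<forall>\<^sub>F k in sequentially. L2_norm (\<lambda>x. u i x - u (r k) x) \<le> e"
      using eventually_ge_at_top[of N]
    proof eventually_elim
      case (elim k)
      with seq_suble[OF r, of k] have "r k \<ge> N" by simp
      with N i show ?case by (simp add: less_imp_le)
    qed
    have m: "(\<lambda>x. u i x - g x) \<in> borel_measurable lebesgue"
      by (intro borel_measurable_diff L2_measurable u gm)
    have l: "AE x in lebesgue. (\<lambda>k. u i x - u (r k) x) \<longlonglongrightarrow> u i x - g x"
      using lim by eventually_elim (intro tendsto_intros)
    show "(\<lambda>x. u i x - g x) \<in> L2" "L2_norm (\<lambda>x. u i x - g x) \<le> e"
      using L2_Fatou[OF L2_diff[OF u u] m l ev e] by auto
  qed
  show thesis
  proof
    \<comment> \<open>Fatou's lemma controls only differences; \<open>g\<close> itself is recovered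
      as \<open>u N - (u N - g)\<close>.\<close>
    from C[of 1] obtain N where "\<forall>i\<ge>N. \<forall>j\<ge>N. L2_norm (\<lambda>x. u i x - u j x) < 1" by auto
    from *(1)[OF this order_refl] have "(\<lambda>x. u N x - (u N x - g x)) \<in> L2"
      by (rule L2_diff[OF u])
    then show "g \<in> L2" by simp
    show "(\<lambda>n. L2_norm (\<lambda>x. u n x - g x)) \<longlonglongrightarrow> 0"
    proof (rule LIMSEQ_I)
      fix e :: real assume "0 < e"
      then have "0 < e / 2" by simp
      from C[OF this] obtain N where N: "\<forall>i\<ge>N. \<forall>j\<ge>N. L2_norm (\<lambda>x. u i x - u j x) < e / 2" by blast
      show "\<exists>N. \<forall>n\<ge>N. norm (L2_norm (\<lambda>x. u n x - g x) - 0) < e"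
      proof (intro exI allI impI)
        fix n assume "n \<ge> N"
        from *(2)[OF N this] \<open>0 < e\<close> show "norm (L2_norm (\<lambda>x. u n x - g x) - 0) < e" by simp
      qed
    qed
  qed
qed

lemma L2_norm_tendsto:
  assumes u: "\<And>n. u n \<in> L2" and g: "g \<in> L2"
    and lim: "((\<lambda>n. L2_norm (\<lambda>x. u n x - g x)) \<longlongrightarrow> 0) F"
  shows "((\<lambda>n. L2_norm (u n)) \<longlongrightarrow> L2_norm g) F"
proof (rule LIM_zero_cancel[OF Lim_null_comparison])
  show "((\<lambda>n. L2_norm (\<lambda>x. u n x - g x)) \<longlongrightarrow> 0) F" by (rule lim)
  show "\<forall>\<^sub>F n in F. norm (L2_norm (u n) - L2_norm g) \<le> L2_norm (\<lambda>x. u n x - g x)"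
    using L2_norm_diff_ineq[OF u g] L2_norm_diff_ineq[OF g u]
    by (intro always_eventually allI) (simp add: abs_le_iff L2_norm_minus_commute[of g] algebra_simps)
qed

text \<open>The pairing carries no conjugation, as in the multiplication formula that is to be
  passed to the limit.\<close>

lemma L2_inner_tendsto:
  assumes u: "\<And>n. u n \<in> L2" and v: "\<And>n. v n \<in> L2" and f: "f \<in> L2" and g: "g \<in> L2"
    and ulim: "(\<lambda>n. L2_norm (\<lambda>x. u n x - f x)) \<longlonglongrightarrow> 0"
    and vlim: "(\<lambda>n. L2_norm (\<lambda>x. v n x - g x)) \<longlonglongrightarrow> 0"
  shows "(\<lambda>n. \<integral>x. u n x * v n x \<partial>lebesgue) \<longlonglongrightarrow> (\<integral>x. f x * g x \<partial>lebesgue)"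
proof (rule LIM_zero_cancel[OF Lim_null_comparison])
  have "(\<lambda>n. L2_norm (\<lambda>x. u n x - f x) * L2_norm (v n) + L2_norm f * L2_norm (\<lambda>x. v n x - g x))
      \<longlonglongrightarrow> 0 * L2_norm g + L2_norm f * 0"
    by (intro tendsto_intros ulim vlim L2_norm_tendsto v g)
  then show "(\<lambda>n. L2_norm (\<lambda>x. u n x - f x) * L2_norm (v n) + L2_norm f * L2_norm (\<lambda>x. v n x - g x)) \<longlonglongrightarrow> 0"
    by simp
  have "norm ((\<integral>x. u n x * v n x \<partial>lebesgue) - (\<integral>x. f x * g x \<partial>lebesgue))
      \<le> L2_norm (\<lambda>x. u n x - f x) * L2_norm (v n) + L2_norm f * L2_norm (\<lambda>x. v n x - g x)" for n
  proof -
    have "(\<integral>x. u n x * v n x \<partial>lebesgue) - (\<integral>x. f x * g x \<partial>lebesgue)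
        = (\<integral>x. u n x * v n x - f x * g x \<partial>lebesgue)"
      by (rule Bochner_Integration.integral_diff[symmetric]) (intro integrable_L2_mult u v f g)+
    also have "\<dots> = (\<integral>x. (u n x - f x) * v n x + f x * (v n x - g x) \<partial>lebesgue)"
      by (simp add: algebra_simps)
    also have "\<dots> = (\<integral>x. (u n x - f x) * v n x \<partial>lebesgue) + (\<integral>x. f x * (v n x - g x) \<partial>lebesgue)"
      by (rule Bochner_Integration.integral_add) (intro integrable_L2_mult L2_diff u v f g)+
    finally have "norm ((\<integral>x. u n x * v n x \<partial>lebesgue) - (\<integral>x. f x * g x \<partial>lebesgue))
       \<le> norm (\<integral>x. (u n x - f x) * v n x \<partial>lebesgue) + norm (\<integral>x. f x * (v n x - g x) \<partial>lebesgue)"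
      by (simp only: norm_triangle_ineq)
    also have "\<dots> \<le> L2_norm (\<lambda>x. u n x - f x) * L2_norm (v n) + L2_norm f * L2_norm (\<lambda>x. v n x - g x)"
      by (intro add_mono L2_inner_bound L2_diff u v f g)
    finally show ?thesis .
  qed
  then show "\<forall>\<^sub>F n in sequentially. norm ((\<integral>x. u n x * v n x \<partial>lebesgue) - (\<integral>x. f x * g x \<partial>lebesgue))
      \<le> L2_norm (\<lambda>x. u n x - f x) * L2_norm (v n) + L2_norm f * L2_norm (\<lambda>x. v n x - g x)"
    by simp
qed


section \<open>The Fourier transform on \<open>L\<^sup>2\<close>\<close>

text \<open>The truncations in the definition of \<open>fourier_L2\<close>. They are integrable as
  products of two members of L2, namely \<open>f\<close> and the indicator of a ball.\<close>

definition truncation :: "real \<Rightarrow> ('a::euclidean_space \<Rightarrow> complex) \<Rightarrow> 'a \<Rightarrow> complex" where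
  "truncation R f = (\<lambda>x. indicator (cball 0 R) x * f x)"

lemma indicator_L2: "(indicator (cball 0 R) :: 'a::euclidean_space \<Rightarrow> complex) \<in> L2"
  by (rule L2_bounded_support[where B = 1 and R = R])
    (auto intro: borel_measurable_indicator simp: indicator_def)

lemma truncation_L2: "f \<in> L2 \<Longrightarrow> truncation R f \<in> L2"
  unfolding truncation_def
  by (rule L2_mult_bounded) (auto simp: indicator_def intro: L2_measurable indicator_L2)

lemma integrable_truncation: "f \<in> L2 \<Longrightarrow> integrable lebesgue (truncation R f)"
  unfolding truncation_def by (intro integrable_L2_mult indicator_L2)

lemma fourier_truncation:
  fixes f :: "'a::euclidean_space \<Rightarrow> complex"
  assumes "f \<in> L2"
  shows "fourier_integral (truncation R f) \<in> L2"
    and "L2_norm (fourier_integral (truncation R f)) = L2_norm (truncation R f)"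
  using fourier_integral_L2 fourier_integral_isometry integrable_truncation[OF assms] truncation_L2[OF assms]
  by blast+

lemma tendsto_truncation:
  fixes f :: "'a::euclidean_space \<Rightarrow> complex"
  assumes f: "f \<in> L2"
  shows "((\<lambda>R. L2_norm (\<lambda>x. truncation R f x - f x)) \<longlongrightarrow> 0) at_top"
proof (rule tendsto_at_topI_sequentially)
  fix X :: "nat \<Rightarrow> real" assume X: "filterlim X at_top sequentially"
  show "(\<lambda>n. L2_norm (\<lambda>x. truncation (X n) f x - f x)) \<longlonglongrightarrow> 0"
  proof (rule L2_dominated_convergence[OF f L2_measurable[OF f] L2_measurable[OF truncation_L2[OF f]]])
    have "(\<lambda>n. truncation (X n) f x) \<longlonglongrightarrow> f x" for x
    proof (rule tendsto_eventually)
      have "\<forall>\<^sub>F n in sequentially. norm x \<le> X n"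
        using X by (simp add: filterlim_at_top)
      then show "\<forall>\<^sub>F n in sequentially. truncation (X n) f x = f x"
        by eventually_elim (simp add: truncation_def)
    qed
    then show "AE x in lebesgue. (\<lambda>n. truncation (X n) f x) \<longlonglongrightarrow> f x" by simp
    show "AE x in lebesgue. norm (truncation (X n) f x) \<le> norm (f x)" for n
      by (simp add: truncation_def indicator_def norm_mult)
  qed
qed

text \<open>The isometry reduces the distance to that of the truncations themselves, and comparison
  with \<open>f\<close> bounds it by two tails. This is the Cauchy property behind the limit
  defining \<open>fourier_L2\<close>.\<close>

lemma L2_norm_fourier_truncation_diff:
  fixes f :: "'a::euclidean_space \<Rightarrow> complex"
  assumes f: "f \<in> L2"
  shows "L2_norm (\<lambda>\<xi>. fourier_integral (truncation R f) \<xi> - fourier_integral (truncation S f) \<xi>)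
    \<le> L2_norm (\<lambda>x. truncation R f x - f x) + L2_norm (\<lambda>x. truncation S f x - f x)"
proof -
  note t = integrable_truncation[OF f] truncation_L2[OF f]
  have "L2_norm (\<lambda>\<xi>. fourier_integral (truncation R f) \<xi> - fourier_integral (truncation S f) \<xi>)
      = L2_norm (fourier_integral (\<lambda>x. truncation R f x - truncation S f x))"
    by (intro arg_cong[where f = L2_norm] ext fourier_integral_diff[symmetric] t)
  also have "\<dots> = L2_norm (\<lambda>x. truncation R f x - truncation S f x)"
    by (intro fourier_integral_isometry Bochner_Integration.integrable_diff L2_diff t)
  also have "\<dots> \<le> L2_norm (\<lambda>x. truncation R f x - f x) + L2_norm (\<lambda>x. f x - truncation S f x)"
    by (intro L2_norm_diff_triangle f t)
  also have "L2_norm (\<lambda>x. f x - truncation S f x) = L2_norm (\<lambda>x. truncation S f x - f x)"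
    by (rule L2_norm_minus_commute)
  finally show ?thesis .
qed

lemma ex_fourier_L2:
  fixes f :: "'a::euclidean_space \<Rightarrow> complex"
  assumes f: "f \<in> L2"
  shows "\<exists>g. g \<in> L2 \<and> ((\<lambda>R. L2_norm (\<lambda>\<xi>. fourier_integral (truncation R f) \<xi> - g \<xi>)) \<longlongrightarrow> 0) at_top"
proof -
  define r where "r R = L2_norm (\<lambda>x. truncation R f x - f x)" for R
  define u where "u n = fourier_integral (truncation (real n) f)" for n
  have r: "(r \<longlongrightarrow> 0) at_top" unfolding r_def by (rule tendsto_truncation[OF f])
  have rn: "(\<lambda>n. r (real n)) \<longlonglongrightarrow> 0" by (rule filterlim_compose[OF r filterlim_real_sequentially])
  note u = fourier_truncation(1)[OF f]
  obtain g where g: "g \<in> L2" "(\<lambda>n. L2_norm (\<lambda>\<xi>. u n \<xi> - g \<xi>)) \<longlonglongrightarrow> 0"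
  proof (rule L2_complete[of u])
    show "u n \<in> L2" for n unfolding u_def by (rule u)
    fix e :: real assume "0 < e"
    then have "\<forall>\<^sub>F n in sequentially. r (real n) < e / 2"
      by (intro order_tendstoD[OF rn]) simp
    then obtain N where N: "\<And>n. n \<ge> N \<Longrightarrow> r (real n) < e / 2"
      by (auto simp: eventually_sequentially)
    show "\<exists>N. \<forall>i\<ge>N. \<forall>j\<ge>N. L2_norm (\<lambda>x. u i x - u j x) < e"
    proof (intro exI allI impI)
      fix i j assume "i \<ge> N" "j \<ge> N"
      with N[of i] N[of j] L2_norm_fourier_truncation_diff[OF f, of i j]
      show "L2_norm (\<lambda>x. u i x - u j x) < e" by (simp add: u_def r_def)
    qed
  qed
  \<comment> \<open>Convergence along the integers is upgraded to real radii: letting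
    \<open>n\<close> grow in the triangle inequality leaves only the tail
    \<open>r R\<close>.\<close>
  have "L2_norm (\<lambda>\<xi>. fourier_integral (truncation R f) \<xi> - g \<xi>) \<le> r R" for R
  proof (rule LIMSEQ_le_const)
    show "(\<lambda>n. r R + r (real n) + L2_norm (\<lambda>\<xi>. u n \<xi> - g \<xi>)) \<longlonglongrightarrow> r R"
      by (auto intro!: tendsto_eq_intros rn g(2))
    have "L2_norm (\<lambda>\<xi>. fourier_integral (truncation R f) \<xi> - g \<xi>)
        \<le> r R + r (real n) + L2_norm (\<lambda>\<xi>. u n \<xi> - g \<xi>)" for n
      using L2_norm_diff_triangle[OF u[of R] u[of "real n"] g(1)]
        L2_norm_fourier_truncation_diff[OF f, of R n]
      by (simp add: u_def r_def)
    then show "\<exists>N. \<forall>n\<ge>N. L2_norm (\<lambda>\<xi>. fourier_integral (truncation R f) \<xi> - g \<xi>)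
        \<le> r R + r (real n) + L2_norm (\<lambda>\<xi>. u n \<xi> - g \<xi>)"
      by blast
  qed
  then have "((\<lambda>R. L2_norm (\<lambda>\<xi>. fourier_integral (truncation R f) \<xi> - g \<xi>)) \<longlongrightarrow> 0) at_top"
    by (intro tendsto_sandwich[OF _ _ tendsto_const r]) auto
  with g(1) show ?thesis by blast
qed

lemma
  fixes f :: "'a::euclidean_space \<Rightarrow> complex"
  assumes f: "f \<in> L2"
  shows fourier_L2_L2: "fourier_L2 f \<in> L2"
    and fourier_L2_tendsto:
      "((\<lambda>R. L2_norm (\<lambda>\<xi>. fourier_integral (truncation R f) \<xi> - fourier_L2 f \<xi>)) \<longlongrightarrow> 0) at_top"
  using someI_ex[OF ex_fourier_L2[OF f]] unfolding truncation_def fourier_L2_def by blast+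

lemma fourier_L2_LIMSEQ:
  assumes f: "f \<in> L2"
  shows "(\<lambda>n. L2_norm (\<lambda>\<xi>. fourier_integral (truncation (real n) f) \<xi> - fourier_L2 f \<xi>)) \<longlonglongrightarrow> 0"
  by (rule filterlim_compose[OF fourier_L2_tendsto[OF f] filterlim_real_sequentially])

lemma fourier_L2_isometry:
  fixes f :: "'a::euclidean_space \<Rightarrow> complex"
  assumes f: "f \<in> L2"
  shows "L2_norm (fourier_L2 f) = L2_norm f"
proof (rule tendsto_unique)
  show "((\<lambda>R. L2_norm (fourier_integral (truncation R f))) \<longlongrightarrow> L2_norm (fourier_L2 f)) at_top"
    by (intro L2_norm_tendsto fourier_L2_tendsto fourier_truncation fourier_L2_L2 f)
  show "((\<lambda>R. L2_norm (fourier_integral (truncation R f))) \<longlongrightarrow> L2_norm f) at_top"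
    unfolding fourier_truncation(2)[OF f]
    by (intro L2_norm_tendsto tendsto_truncation truncation_L2 f)
qed simp

text \<open>The selected representatives need not respect differences pointwise. Transforms of
  truncations do so exactly, which bounds the norm of the defect \<open>d\<close> by three
  approximation errors that tend to 0.\<close>

lemma fourier_L2_diff:
  fixes f g :: "'a::euclidean_space \<Rightarrow> complex"
  assumes f: "f \<in> L2" and g: "g \<in> L2"
  shows "AE \<xi> in lebesgue. fourier_L2 (\<lambda>x. f x - g x) \<xi> = fourier_L2 f \<xi> - fourier_L2 g \<xi>"
proof -
  define h where "h = (\<lambda>x. f x - g x)"
  have h: "h \<in> L2" unfolding h_def by (rule L2_diff[OF f g])
  define d where "d = (\<lambda>\<xi>. fourier_L2 h \<xi> - (fourier_L2 f \<xi> - fourier_L2 g \<xi>))"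
  define F where "F n k = fourier_integral (truncation (real n) k)" for n and k :: "'a \<Rightarrow> complex"
  have F: "F n k \<in> L2" if "k \<in> L2" for n k
    unfolding F_def by (rule fourier_truncation[OF that])
  note T = fourier_L2_L2 f g h F L2_diff
  have d: "d \<in> L2" unfolding d_def by (intro T)
  have Fh: "F n h \<xi> = F n f \<xi> - F n g \<xi>" for n \<xi>
  proof -
    have "truncation n h = (\<lambda>x. truncation n f x - truncation n g x)"
      by (simp add: truncation_def h_def right_diff_distrib)
    then show ?thesis
      unfolding F_def by (simp add: fourier_integral_diff integrable_truncation truncation_L2 f g)
  qed
  have "L2_norm d \<le> 0"
  proof (rule LIMSEQ_le_const)
    show "(\<lambda>n. L2_norm (\<lambda>\<xi>. F n h \<xi> - fourier_L2 h \<xi>) + (L2_norm (\<lambda>\<xi>. F n f \<xi> - fourier_L2 f \<xi>)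
        + L2_norm (\<lambda>\<xi>. F n g \<xi> - fourier_L2 g \<xi>))) \<longlonglongrightarrow> 0"
      using tendsto_add[OF fourier_L2_LIMSEQ[OF h] tendsto_add[OF fourier_L2_LIMSEQ[OF f] fourier_L2_LIMSEQ[OF g]]]
      by (simp add: F_def)
    have "L2_norm d \<le> L2_norm (\<lambda>\<xi>. F n h \<xi> - fourier_L2 h \<xi>) + (L2_norm (\<lambda>\<xi>. F n f \<xi> - fourier_L2 f \<xi>)
        + L2_norm (\<lambda>\<xi>. F n g \<xi> - fourier_L2 g \<xi>))" for n
    proof -
      have "L2_norm d \<le> L2_norm (\<lambda>\<xi>. fourier_L2 h \<xi> - F n h \<xi>) + L2_norm (\<lambda>\<xi>. F n h \<xi> - (fourier_L2 f \<xi> - fourier_L2 g \<xi>))"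
        unfolding d_def by (intro L2_norm_diff_triangle T)
      also have "L2_norm (\<lambda>\<xi>. fourier_L2 h \<xi> - F n h \<xi>) = L2_norm (\<lambda>\<xi>. F n h \<xi> - fourier_L2 h \<xi>)"
        by (rule L2_norm_minus_commute)
      also have "L2_norm (\<lambda>\<xi>. F n h \<xi> - (fourier_L2 f \<xi> - fourier_L2 g \<xi>))
          = L2_norm (\<lambda>\<xi>. (F n f \<xi> - fourier_L2 f \<xi>) - (F n g \<xi> - fourier_L2 g \<xi>))"
        by (simp add: Fh algebra_simps)
      also have "\<dots> \<le> L2_norm (\<lambda>\<xi>. (F n f \<xi> - fourier_L2 f \<xi>) - 0) + L2_norm (\<lambda>\<xi>. 0 - (F n g \<xi> - fourier_L2 g \<xi>))"
        by (intro L2_norm_diff_triangle T) (simp add: L2_def)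
      also have "L2_norm (\<lambda>\<xi>. 0 - (F n g \<xi> - fourier_L2 g \<xi>)) = L2_norm (\<lambda>\<xi>. F n g \<xi> - fourier_L2 g \<xi>)"
        using L2_norm_minus_commute[of "\<lambda>_. 0" "\<lambda>\<xi>. F n g \<xi> - fourier_L2 g \<xi>"] by simp
      finally show ?thesis by simp
    qed
    then show "\<exists>N. \<forall>n\<ge>N. L2_norm d \<le> L2_norm (\<lambda>\<xi>. F n h \<xi> - fourier_L2 h \<xi>)
        + (L2_norm (\<lambda>\<xi>. F n f \<xi> - fourier_L2 f \<xi>) + L2_norm (\<lambda>\<xi>. F n g \<xi> - fourier_L2 g \<xi>))"
      by blast
  qed
  then have "L2_norm d = 0" by (simp add: antisym)
  from L2_norm_eq_0_AE[OF d this] show ?thesis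
    unfolding d_def h_def by (auto elim!: eventually_mono)
qed

lemma fourier_L2_multiplication_formula:
  fixes f g :: "'a::euclidean_space \<Rightarrow> complex"
  assumes f: "f \<in> L2" and g: "g \<in> L2"
  shows "(\<integral>x. fourier_L2 f x * g x \<partial>lebesgue) = (\<integral>x. f x * fourier_L2 g x \<partial>lebesgue)"
proof (rule LIMSEQ_unique)
  have tr: "(\<lambda>n. L2_norm (\<lambda>x. truncation (real n) h x - h x)) \<longlonglongrightarrow> 0" if "h \<in> L2" for h :: "'a \<Rightarrow> complex"
    by (rule filterlim_compose[OF tendsto_truncation[OF that] filterlim_real_sequentially])
  show "(\<lambda>n. \<integral>x. fourier_integral (truncation (real n) f) x * truncation (real n) g x \<partial>lebesgue)
      \<longlonglongrightarrow> (\<integral>x. fourier_L2 f x * g x \<partial>lebesgue)"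
    by (intro L2_inner_tendsto fourier_truncation truncation_L2 fourier_L2_L2 fourier_L2_LIMSEQ tr f g)
  have "(\<lambda>n. \<integral>x. truncation (real n) f x * fourier_integral (truncation (real n) g) x \<partial>lebesgue)
      \<longlonglongrightarrow> (\<integral>x. f x * fourier_L2 g x \<partial>lebesgue)"
    by (intro L2_inner_tendsto fourier_truncation truncation_L2 fourier_L2_L2 fourier_L2_LIMSEQ tr f g)
  then show "(\<lambda>n. \<integral>x. fourier_integral (truncation (real n) f) x * truncation (real n) g x \<partial>lebesgue)
      \<longlonglongrightarrow> (\<integral>x. f x * fourier_L2 g x \<partial>lebesgue)"
    by (simp only: fourier_multiplication_formula_lebesgue integrable_truncation truncation_L2 f g)
qed

lemma L2_norm_diff_power2:
  assumes f: "f \<in> L2" and g: "g \<in> L2"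
  shows "(L2_norm (\<lambda>x. f x - g x))\<^sup>2
    = (L2_norm f)\<^sup>2 + (L2_norm g)\<^sup>2 - 2 * Re (\<integral>x. f x * cnj (g x) \<partial>lebesgue)"
proof -
  have i: "integrable lebesgue (\<lambda>x. f x * cnj (g x))" by (intro integrable_L2_mult L2_cnj f g)
  have "(norm (a - b))\<^sup>2 = (norm a)\<^sup>2 + (norm b)\<^sup>2 - 2 * Re (a * cnj b)" for a b :: complex
    unfolding cmod_power2 by (simp add: power2_eq_square algebra_simps)
  then have "(L2_norm (\<lambda>x. f x - g x))\<^sup>2
      = (\<integral>x. (norm (f x))\<^sup>2 + (norm (g x))\<^sup>2 - 2 * Re (f x * cnj (g x)) \<partial>lebesgue)"
    by (simp only: L2_norm_power2)
  also have "\<dots> = (\<integral>x. (norm (f x))\<^sup>2 + (norm (g x))\<^sup>2 \<partial>lebesgue) - (\<integral>x. 2 * Re (f x * cnj (g x)) \<partial>lebesgue)"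
    by (intro Bochner_Integration.integral_diff Bochner_Integration.integrable_add L2_integrable f g integrable_mult_right integrable_Re i)
  also have "(\<integral>x. (norm (f x))\<^sup>2 + (norm (g x))\<^sup>2 \<partial>lebesgue) = (L2_norm f)\<^sup>2 + (L2_norm g)\<^sup>2"
    unfolding L2_norm_power2 by (intro Bochner_Integration.integral_add L2_integrable f g)
  also have "(\<integral>x. 2 * Re (f x * cnj (g x)) \<partial>lebesgue) = 2 * Re (\<integral>x. f x * cnj (g x) \<partial>lebesgue)"
    by (simp only: integral_mult_right_zero integral_Re[OF i])
  finally show ?thesis .
qed

lemma L2_inner_self: "(\<integral>x. f x * cnj (f x) \<partial>lebesgue) = of_real ((L2_norm f)\<^sup>2)"
  by (simp only: L2_norm_power2 complex_norm_square[symmetric] integral_complex_of_real)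

text \<open>The multiplication formula says that \<open>h \<mapsto> cnj (fourier_L2 (cnj h))\<close> is the adjoint of
  \<open>fourier_L2\<close>. Both are isometries, so the adjoint is a right inverse as well.\<close>

lemma fourier_L2_surj:
  fixes h :: "'a::euclidean_space \<Rightarrow> complex"
  assumes h: "h \<in> L2"
  shows "\<exists>f\<in>L2. AE \<xi> in lebesgue. fourier_L2 f \<xi> = h \<xi>"
proof
  define f where "f = (\<lambda>x. cnj (fourier_L2 (\<lambda>\<xi>. cnj (h \<xi>)) x))"
  show f: "f \<in> L2" unfolding f_def by (intro L2_cnj fourier_L2_L2 h)
  have nf: "L2_norm f = L2_norm h"
    unfolding f_def by (simp only: L2_norm_cnj fourier_L2_isometry[OF L2_cnj[OF h]])
  \<comment> \<open>The pairing equals \<open>(L2_norm h)\<^sup>2\<close>, and both of its entries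
    have norm \<open>L2_norm h\<close>. This is the equality case of Cauchy-Schwarz, so expanding
    the squared distance gives 0.\<close>
  have "(\<integral>x. fourier_L2 f x * cnj (h x) \<partial>lebesgue) = (\<integral>x. f x * cnj (f x) \<partial>lebesgue)"
    unfolding fourier_L2_multiplication_formula[OF f L2_cnj[OF h]] by (simp add: f_def)
  then have "(L2_norm (\<lambda>x. fourier_L2 f x - h x))\<^sup>2 = 0"
    unfolding L2_norm_diff_power2[OF fourier_L2_L2[OF f] h] fourier_L2_isometry[OF f] L2_inner_self nf
    by simp
  then have "L2_norm (\<lambda>x. fourier_L2 f x - h x) = 0" by simp
  from L2_norm_eq_0_AE[OF L2_diff[OF fourier_L2_L2[OF f] h] this]
  show "AE \<xi> in lebesgue. fourier_L2 f \<xi> = h \<xi>" by simp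
qed

lemma
  fixes h :: "'a::euclidean_space \<Rightarrow> complex"
  assumes "h \<in> L2"
  shows inv_fourier_L2_L2: "inv_fourier_L2 h \<in> L2"
    and fourier_inv_fourier_L2: "AE \<xi> in lebesgue. fourier_L2 (inv_fourier_L2 h) \<xi> = h \<xi>"
  using someI_ex[of "\<lambda>f. f \<in> L2 \<and> (AE \<xi> in lebesgue. fourier_L2 f \<xi> = h \<xi>)"] fourier_L2_surj[OF assms]
  unfolding inv_fourier_L2_def by blast+


section \<open>The energy of the high frequencies\<close>

lemma lebesgue_norm_sets:
  "{\<xi>::'a::euclidean_space. norm \<xi> > \<omega>} \<in> sets lebesgue" "{\<xi>::'a. norm \<xi> \<le> \<omega>} \<in> sets lebesgue"
  by (rule sets_completionI_sets, measurable)+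

text \<open>Phrasing \<open>ev\<close> as eventual agreement at each point covers both levels
  escaping to infinity, with \<open>T\<close> empty, and levels descending to a limit, with
  \<open>T\<close> its strict superlevel set.\<close>

lemma set_integral_tendsto_superlevel:
  fixes W :: "'a::euclidean_space \<Rightarrow> real"
  assumes W: "integrable lebesgue W" and T: "T \<in> sets lebesgue"
    and ev: "\<And>\<xi>. \<forall>\<^sub>F n in sequentially. X n < norm \<xi> \<longleftrightarrow> \<xi> \<in> T"
  shows "(\<lambda>n. LINT \<xi>:{\<xi>. norm \<xi> > X n}|lebesgue. W \<xi>) \<longlonglongrightarrow> (LINT \<xi>:T|lebesgue. W \<xi>)"
  unfolding set_lebesgue_integral_def
proof (rule integral_dominated_convergence[OF _ _ integrable_norm[OF W]])
  have Wm: "W \<in> borel_measurable lebesgue" using W by auto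
  have S: "{\<xi>::'a. norm \<xi> > X n} \<in> sets lebesgue" for n
    by (rule lebesgue_norm_sets)
  show "(\<lambda>\<xi>. indicator T \<xi> *\<^sub>R W \<xi>) \<in> borel_measurable lebesgue"
    by (intro borel_measurable_scaleR borel_measurable_indicator T Wm)
  show "(\<lambda>\<xi>. indicator {\<xi>. norm \<xi> > X n} \<xi> *\<^sub>R W \<xi>) \<in> borel_measurable lebesgue" for n
    by (intro borel_measurable_scaleR borel_measurable_indicator S Wm)
  have "(\<lambda>n. indicator {\<xi>. norm \<xi> > X n} \<xi> *\<^sub>R W \<xi>) \<longlonglongrightarrow> indicator T \<xi> *\<^sub>R W \<xi>" for \<xi>
    by (rule tendsto_eventually) (use ev[of \<xi>] in eventually_elim, simp add: indicator_def)
  then show "AE \<xi> in lebesgue. (\<lambda>n. indicator {\<xi>. norm \<xi> > X n} \<xi> *\<^sub>R W \<xi>) \<longlonglongrightarrow> indicator T \<xi> *\<^sub>R W \<xi>"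
    by simp
  show "AE \<xi> in lebesgue. norm (indicator {\<xi>. norm \<xi> > X n} \<xi> *\<^sub>R W \<xi>) \<le> norm (W \<xi>)" for n
    by (simp add: indicator_def)
qed

lemma powi_neg_le_1: "1 \<le> x \<Longrightarrow> x powi (- int n) \<le> 1" for x :: real
  by (simp add: power_int_minus one_le_power inverse_le_1_iff)

lemma integrable_envelope_energy:
  fixes f :: "'a::euclidean_space \<Rightarrow> complex"
  assumes f: "f \<in> L2"
  shows "integrable lebesgue (\<lambda>\<xi>. (1 + norm \<xi>) powi (- 2 * int L) * (norm (f \<xi>))\<^sup>2)"
proof (rule Bochner_Integration.integrable_bound[OF L2_integrable[OF f]])
  have [measurable]: "f \<in> borel_measurable lebesgue" using f by (rule L2_measurable)
  have "(\<lambda>\<xi>::'a. inverse ((1 + norm \<xi>) ^ (2 * L))) \<in> borel_measurable borel" by measurable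
  moreover have "- 2 * int L = - int (2 * L)" by simp
  ultimately have [measurable]: "(\<lambda>\<xi>::'a. (1 + norm \<xi>) powi (- 2 * int L)) \<in> borel_measurable lebesgue"
    by (intro borel_imp_lebesgue) (simp only: power_int_minus power_int_of_nat)
  show "(\<lambda>\<xi>. (1 + norm \<xi>) powi (- 2 * int L) * (norm (f \<xi>))\<^sup>2) \<in> borel_measurable lebesgue"
    by measurable
  have "(1 + norm \<xi>) powi (- 2 * int L) \<le> 1" for \<xi> :: 'a
    using powi_neg_le_1[of "1 + norm \<xi>" "2 * L"] by simp
  then show "AE \<xi> in lebesgue. norm ((1 + norm \<xi>) powi (- 2 * int L) * (norm (f \<xi>))\<^sup>2) \<le> norm ((norm (f \<xi>))\<^sup>2)"
    by (intro AE_I2) (simp add: abs_mult mult_left_le_one_le)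
qed

text \<open>The inequality defining the cutoff passes to the infimum, since the integral over
  \<open>{\<xi>. norm \<xi> > \<Omega>}\<close> is right-continuous in \<open>\<Omega>\<close>.\<close>

lemma cutoff_bound:
  fixes f :: "'a::euclidean_space \<Rightarrow> complex" and L :: nat
  assumes f: "f \<in> L2" and \<epsilon>: "0 < \<epsilon>"
  defines "I \<equiv> \<lambda>\<Omega>. LINT \<xi>:{\<xi>. norm \<xi> > \<Omega>}|lebesgue. (1 + norm \<xi>) powi (- 2 * int L) * (norm (fourier_L2 f \<xi>))\<^sup>2"
  shows "C ^ (2 * L) * I (cutoff C \<epsilon> f L) \<le> \<epsilon> * (L2_norm f)\<^sup>2"
proof -
  define W where "W \<xi> = (1 + norm \<xi>) powi (- 2 * int L) * (norm (fourier_L2 f \<xi>))\<^sup>2" for \<xi>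
  have W: "integrable lebesgue W"
    unfolding W_def by (rule integrable_envelope_energy[OF fourier_L2_L2[OF f]])
  have I: "I \<Omega> = (LINT \<xi>:{\<xi>. norm \<xi> > \<Omega>}|lebesgue. W \<xi>)" for \<Omega>
    by (simp add: I_def W_def)
  define S where "S = {\<Omega>. \<Omega> > 0 \<and> C ^ (2 * L) * I \<Omega> \<le> \<epsilon> * (L2_norm f)\<^sup>2}"
  have c: "cutoff C \<epsilon> f L = Inf S"
    by (simp add: cutoff_def S_def I_def)
  have "S \<noteq> {}"
  \<comment> \<open>If the norm is 0, the bound to be met is 0, and convergence of the tails to 0
    does not suffice; but then the transform vanishes almost everywhere and any positive level will
    do.\<close>
  proof (cases "L2_norm f = 0")
    case True
    then have "AE \<xi> in lebesgue. fourier_L2 f \<xi> = 0"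
      by (intro L2_norm_eq_0_AE fourier_L2_L2 f) (simp add: fourier_L2_isometry f)
    then have "I 1 = 0"
      unfolding I set_lebesgue_integral_def
      by (intro integral_eq_zero_AE) (auto simp: W_def elim!: eventually_mono)
    then have "1 \<in> S" by (simp add: S_def True)
    then show ?thesis by blast
  next
    case False
    have "(\<lambda>n. I (real n)) \<longlonglongrightarrow> (LINT \<xi>:{}|lebesgue. W \<xi>)"
      unfolding I
    proof (rule set_integral_tendsto_superlevel[OF W])
      fix \<xi> :: 'a
      have "\<forall>\<^sub>F n in sequentially. norm \<xi> \<le> real n" by real_asymp
      then show "\<forall>\<^sub>F n in sequentially. real n < norm \<xi> \<longleftrightarrow> \<xi> \<in> {}"
        by eventually_elim simp
    qed simp
    then have "(\<lambda>n. C ^ (2 * L) * I (real n)) \<longlonglongrightarrow> C ^ (2 * L) * 0"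
      by (intro tendsto_mult_left) (simp add: set_lebesgue_integral_def)
    moreover have "0 < \<epsilon> * (L2_norm f)\<^sup>2" using \<epsilon> False by simp
    ultimately have "\<forall>\<^sub>F n in sequentially. C ^ (2 * L) * I (real n) < \<epsilon> * (L2_norm f)\<^sup>2"
      by (intro order_tendstoD) auto
    with eventually_gt_at_top[of 0] have "\<forall>\<^sub>F n in sequentially. real n \<in> S"
      by eventually_elim (simp add: S_def)
    then show ?thesis by (auto simp: eventually_sequentially)
  qed
  have bdd: "bdd_below S" by (rule bdd_belowI[of _ 0]) (simp add: S_def)
  \<comment> \<open>\<open>Inf S\<close> need not belong to \<open>S\<close>, for instance when it
    is 0, so it is approached by members of \<open>S\<close>.\<close>
  have "\<exists>x\<in>S. x < Inf S + 1 / Suc n" for n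
    using cInf_lessD[OF \<open>S \<noteq> {}\<close>, of "Inf S + 1 / Suc n"] by auto
  then obtain X where X: "\<And>n. X n \<in> S" "\<And>n. X n < Inf S + 1 / Suc n" by metis
  have ge: "Inf S \<le> X n" for n by (rule cInf_lower[OF X(1) bdd])
  have "X \<longlonglongrightarrow> Inf S"
  proof (rule tendsto_sandwich[OF _ _ tendsto_const])
    show "(\<lambda>n. Inf S + 1 / Suc n) \<longlonglongrightarrow> Inf S" by real_asymp
  qed (use ge X(2)[THEN less_imp_le] in auto)
  have "(\<lambda>n. I (X n)) \<longlonglongrightarrow> I (Inf S)"
    unfolding I
  proof (rule set_integral_tendsto_superlevel[OF W])
    show "{\<xi>::'a. Inf S < norm \<xi>} \<in> sets lebesgue"
      by (rule lebesgue_norm_sets)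
    fix \<xi> :: 'a
    show "\<forall>\<^sub>F n in sequentially. X n < norm \<xi> \<longleftrightarrow> \<xi> \<in> {\<xi>. Inf S < norm \<xi>}"
    proof (cases "Inf S < norm \<xi>")
      case True
      with order_tendstoD(2)[OF \<open>X \<longlonglongrightarrow> Inf S\<close>] show ?thesis by simp
    next
      case False
      \<comment> \<open>Approach from above matters for \<open>norm \<xi> = Inf S\<close>: such
        points lie outside every set \<open>{\<xi>. norm \<xi> > X n}\<close>, as they do in the
        limit.\<close>
      then have "\<not> X n < norm \<xi>" for n using ge[of n] by simp
      with False show ?thesis by simp
    qed
  qed
  then have "(\<lambda>n. C ^ (2 * L) * I (X n)) \<longlonglongrightarrow> C ^ (2 * L) * I (Inf S)"
    by (rule tendsto_mult_left)
  then have "C ^ (2 * L) * I (Inf S) \<le> \<epsilon> * (L2_norm f)\<^sup>2"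
    by (rule LIMSEQ_le_const2) (use X(1) in \<open>auto simp: S_def\<close>)
  then show ?thesis by (simp add: c)
qed

text \<open>Acts on the frequency side; the strict inequality complements the \<open>\<le>\<close>
  in \<open>proj_low\<close>.\<close>

definition high_part :: "real \<Rightarrow> ('a::euclidean_space \<Rightarrow> complex) \<Rightarrow> 'a \<Rightarrow> complex" where
  "high_part \<omega> f = (\<lambda>\<xi>. indicator {\<xi>. norm \<xi> > \<omega>} \<xi> * f \<xi>)"

lemma high_part_L2: "f \<in> L2 \<Longrightarrow> high_part \<omega> f \<in> L2"
  unfolding high_part_def
  by (rule L2_mult_bounded; (intro borel_measurable_indicator lebesgue_norm_sets)?)
    (simp_all add: indicator_def)

text \<open>\<open>proj_low\<close> is determined only through its transform and only up to null
  sets, so the comparison is made between transforms and brought back by the isometry.\<close>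

lemma L2_norm_proj_high:
  fixes Y :: "'a::euclidean_space \<Rightarrow> complex"
  assumes Y: "Y \<in> L2"
  shows "L2_norm (proj_high \<omega> Y) = L2_norm (high_part \<omega> (fourier_L2 Y))"
proof -
  define h where "h = (\<lambda>\<xi>. indicator {\<xi>. norm \<xi> \<le> \<omega>} \<xi> * fourier_L2 Y \<xi>)"
  have h: "h \<in> L2"
    unfolding h_def
    by (intro L2_mult_bounded fourier_L2_L2 Y borel_measurable_indicator lebesgue_norm_sets)
      (simp add: indicator_def)
  have P: "proj_low \<omega> Y \<in> L2" "AE \<xi> in lebesgue. fourier_L2 (proj_low \<omega> Y) \<xi> = h \<xi>"
    unfolding proj_low_def h_def[symmetric] by (rule inv_fourier_L2_L2[OF h] fourier_inv_fourier_L2[OF h])+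
  have Q: "proj_high \<omega> Y \<in> L2"
    unfolding proj_high_def by (rule L2_diff[OF Y P(1)])
  have "AE \<xi> in lebesgue. fourier_L2 (proj_high \<omega> Y) \<xi> = high_part \<omega> (fourier_L2 Y) \<xi>"
    using fourier_L2_diff[OF Y P(1)] P(2)
    unfolding proj_high_def[symmetric]
    by eventually_elim (auto simp: h_def high_part_def indicator_def)
  then have "L2_norm (fourier_L2 (proj_high \<omega> Y)) = L2_norm (high_part \<omega> (fourier_L2 Y))"
    by (intro L2_norm_cong_AE L2_measurable high_part_L2 fourier_L2_L2 Y Q) (auto elim!: eventually_mono)
  then show ?thesis
    by (simp add: fourier_L2_isometry[OF Q])
qed

lemma L2_norm_diff_ge_high_part:
  fixes f g :: "'a::euclidean_space \<Rightarrow> complex"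
  assumes f: "f \<in> L2" and g: "g \<in> L2"
  shows "L2_norm (high_part \<omega> (fourier_L2 f)) - L2_norm (high_part \<omega> (fourier_L2 g)) \<le> L2_norm (\<lambda>x. f x - g x)"
proof -
  let ?F = "fourier_L2 f" and ?G = "fourier_L2 g"
  note F = fourier_L2_L2[OF f] and G = fourier_L2_L2[OF g]
  have "L2_norm (high_part \<omega> ?F) - L2_norm (high_part \<omega> ?G) \<le> L2_norm (\<lambda>\<xi>. high_part \<omega> ?F \<xi> - high_part \<omega> ?G \<xi>)"
    using L2_norm_diff_ineq[OF high_part_L2[OF F, of \<omega>] high_part_L2[OF G, of \<omega>]] by simp
  also have "\<dots> \<le> L2_norm (\<lambda>\<xi>. ?F \<xi> - ?G \<xi>)"
    by (intro L2_norm_mono L2_diff high_part_L2 F G) (simp add: high_part_def indicator_def)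
  also have "\<dots> = L2_norm (fourier_L2 (\<lambda>x. f x - g x))"
    using fourier_L2_diff[OF f g]
    by (intro L2_norm_cong_AE L2_measurable L2_diff fourier_L2_L2 f g) (auto elim!: eventually_mono)
  also have "\<dots> = L2_norm (\<lambda>x. f x - g x)"
    by (rule fourier_L2_isometry[OF L2_diff[OF f g]])
  finally show ?thesis .
qed

text \<open>Squaring the envelope gives
  \<open>C ^ (2 * L) * (1 + norm \<xi>) powi (- 2 * int L)\<close>, precisely the weight in the
  definition of \<open>cutoff\<close>.\<close>

lemma L2_norm_high_part_cnn_output:
  fixes f g :: "'a::euclidean_space \<Rightarrow> complex"
  assumes f: "f \<in> L2" and env: "envelope_constant L C k" and out: "cnn_output L k f g"
  shows "(L2_norm (high_part \<omega> (fourier_L2 g)))\<^sup>2 \<le> C ^ (2 * L) *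
    (LINT \<xi>:{\<xi>. norm \<xi> > \<omega>}|lebesgue. (1 + norm \<xi>) powi (- 2 * int L) * (norm (fourier_L2 f \<xi>))\<^sup>2)"
proof -
  define W where "W \<xi> = (1 + norm \<xi>) powi (- 2 * int L) * (norm (fourier_L2 f \<xi>))\<^sup>2" for \<xi>
  have W: "integrable lebesgue W"
    unfolding W_def by (rule integrable_envelope_energy[OF fourier_L2_L2[OF f]])
  have g: "g \<in> L2" and eq: "AE \<xi> in lebesgue. fourier_L2 g \<xi> = freq_response L k \<xi> * fourier_L2 f \<xi>"
    using out by (auto simp: cnn_output_def)
  have resp: "(norm (freq_response L k \<xi>))\<^sup>2 \<le> C ^ (2 * L) * (1 + norm \<xi>) powi (- 2 * int L)" for \<xi>
  proof -
    have "(norm (freq_response L k \<xi>))\<^sup>2 \<le> (C ^ L * (1 + norm \<xi>) powi (- int L))\<^sup>2"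
      using env by (intro power_mono) (auto simp: envelope_constant_def)
    also have "\<dots> = (C ^ L)\<^sup>2 * ((1 + norm \<xi>) powi (- int L))\<^sup>2" by (rule power_mult_distrib)
    also have "(C ^ L)\<^sup>2 = C ^ (2 * L)" by (simp add: power_mult[symmetric] mult.commute)
    also have "((1 + norm \<xi>) powi (- int L))\<^sup>2 = (1 + norm \<xi>) powi (- 2 * int L)"
      using power_int_mult[of "1 + norm \<xi>" "- int L" 2] by (simp add: mult.commute)
    finally show ?thesis .
  qed
  have "(L2_norm (high_part \<omega> (fourier_L2 g)))\<^sup>2
      \<le> (\<integral>\<xi>. C ^ (2 * L) * (indicator {\<xi>. norm \<xi> > \<omega>} \<xi> *\<^sub>R W \<xi>) \<partial>lebesgue)"
    unfolding L2_norm_power2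
  proof (rule integral_mono_AE)
    show "integrable lebesgue (\<lambda>\<xi>. (norm (high_part \<omega> (fourier_L2 g) \<xi>))\<^sup>2)"
      by (intro L2_integrable high_part_L2 fourier_L2_L2 g)
    have "{\<xi>::'a. norm \<xi> > \<omega>} \<in> sets lebesgue"
      by (rule lebesgue_norm_sets)
    then show "integrable lebesgue (\<lambda>\<xi>. C ^ (2 * L) * (indicator {\<xi>. norm \<xi> > \<omega>} \<xi> *\<^sub>R W \<xi>))"
      by (intro integrable_mult_right integrable_mult_indicator W)
    show "AE \<xi> in lebesgue. (norm (high_part \<omega> (fourier_L2 g) \<xi>))\<^sup>2
        \<le> C ^ (2 * L) * (indicator {\<xi>. norm \<xi> > \<omega>} \<xi> *\<^sub>R W \<xi>)"
      using eq
    proof eventually_elim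
      case (elim \<xi>)
      then show ?case
        using mult_right_mono[OF resp[of \<xi>], of "(norm (fourier_L2 f \<xi>))\<^sup>2"]
        by (simp add: high_part_def indicator_def W_def norm_mult power_mult_distrib mult.assoc)
    qed
  qed
  also have "\<dots> = C ^ (2 * L) * (LINT \<xi>:{\<xi>. norm \<xi> > \<omega>}|lebesgue. W \<xi>)"
    unfolding set_lebesgue_integral_def by (rule integral_mult_right_zero)
  finally show ?thesis by (simp only: W_def)
qed

theorem corollary1:
  fixes L :: nat and C \<epsilon> \<omega>\<^sub>c :: real
    and Y0 Y Yt Yhigh :: "real^'n \<Rightarrow> complex"
    and k :: "nat \<Rightarrow> real^'n \<Rightarrow> complex"
  assumes "L \<ge> 1" and "C > 0" and "0 < \<epsilon>" and "\<epsilon> < 1"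
    and "Y0 \<in> L2"
    and "\<omega>\<^sub>c = cutoff C \<epsilon> Y0 L"
    and "Y \<in> L2"
    and "Yhigh = proj_high \<omega>\<^sub>c Y"
    and "L2_norm Yhigh > sqrt \<epsilon> * L2_norm Y0"
    and "\<And>l. 1 \<le> l \<Longrightarrow> l \<le> L \<Longrightarrow> cnn_kernel (k l)"
    and "envelope_constant L C k"
    and "cnn_output L k Y0 Yt"
  shows "(L2_norm (\<lambda>x. Y x - Yt x))\<^sup>2 \<ge> (L2_norm Yhigh - sqrt \<epsilon> * L2_norm Y0)\<^sup>2
       \<and> (L2_norm Yhigh - sqrt \<epsilon> * L2_norm Y0)\<^sup>2 > 0"
proof -
  have Yt: "Yt \<in> L2" using assms(12) by (simp add: cnn_output_def)
  \<comment> \<open>At \<open>\<omega>\<^sub>c\<close> the bound on the output energy is the very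
    expression that the cutoff controls, and it depends on the kernels only through \<open>L\<close>
    and \<open>C\<close>.\<close>
  have "(L2_norm (high_part \<omega>\<^sub>c (fourier_L2 Yt)))\<^sup>2 \<le> \<epsilon> * (L2_norm Y0)\<^sup>2"
    using L2_norm_high_part_cnn_output[OF assms(5,11,12)] cutoff_bound[OF assms(5,3)]
    unfolding assms(6) by (rule order_trans)
  also have "\<dots> = (sqrt \<epsilon> * L2_norm Y0)\<^sup>2" using assms(3) by (simp add: power_mult_distrib)
  finally have "L2_norm (high_part \<omega>\<^sub>c (fourier_L2 Yt)) \<le> sqrt \<epsilon> * L2_norm Y0"
    by (rule power2_le_imp_le) (use assms(3) in simp)
  then have "L2_norm Yhigh - sqrt \<epsilon> * L2_norm Y0 \<le> L2_norm (\<lambda>x. Y x - Yt x)"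
    using L2_norm_diff_ge_high_part[OF assms(7) Yt, of \<omega>\<^sub>c] L2_norm_proj_high[OF assms(7), of \<omega>\<^sub>c] assms(8)
    by simp
  \<comment> \<open>Positivity of the gap both permits squaring the inequality and gives the strict
    bound.\<close>
  then show ?thesis using assms(9) by (auto intro: power_mono)
qed

end
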